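(* Let $\rho$ be a two-qubit density matrix, let $R$ be the real $4\times4$ matrix with elements $R_{ij}=\operatorname{Tr}(\rho(\sigma_i\otimes\sigma_j))$, $i,j\in\{0,1,2,3\}$, and suppose that $R=L_1\Sigma L_2^T$ with $L_1,L_2$ proper orthochronous Lorentz transformations and $\Sigma=\operatorname{diag}[s_0,s_1,s_2,s_3]$, $s_0\ge s_1\ge s_2\ge|s_3|$. Then among all states $$\rho'=\frac{(A\otimes B)\rho(A\otimes B)^\dagger}{\operatorname{Tr}\left((A\otimes B)\rho(A\otimes B)^\dagger\right)},\qquad A^\dagger A\le I_2,\ B^\dagger B\le I_2,\ \det(A)\ne0,\ \det(B)\neq0,$$ the maximal concurrence is attained by the Bell diagonal state $$\rho_\Sigma=\frac{1}{4s_0}\sum_{i=0}^3 s_i\,\sigma_i\otimes\sigma_i .$$ This state is obtained by taking for $A$ and $B$ the $2\times2$ matrices corresponding to the Lorentz transformations $ML_1^TM=L_1^{-1}$ and $ML_2^TM=L_2^{-1}$ respectively, each divided by its largest singular value. Moreover, the rank of $\rho_\Sigma$ equals the rank of $\rho$.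
   Context: A two-qubit density matrix is a positive semidefinite complex $4\times4$ matrix on $\mathbb{C}^2\otimes\mathbb{C}^2$ of trace one. $\sigma_0=I_2$ and $\sigma_1=\begin{pmatrix}0&1\\1&0\end{pmatrix}$, $\sigma_2=\sigma_y=\begin{pmatrix}0&-i\\i&0\end{pmatrix}$, $\sigma_3=\begin{pmatrix}1&0\\0&-1\end{pmatrix}$ are the Pauli matrices. With $M=\operatorname{diag}[1,-1,-1,-1]$, a proper orthochronous Lorentz transformation is a real $4\times4$ matrix $L$ (indices $0,\dots,3$) with $LML^T=M$, $\det L=1$ and $L_{00}>0$. An invertible complex $2\times2$ matrix $A$ corresponds to the proper orthochronous Lorentz transformation $L_A=T(A\otimes A^* )T^\dagger/|\det(A)|$, where $A^*$ is the entrywise complex conjugate and $T=\frac{1}{\sqrt2}\begin{pmatrix}1&0&0&1\\0&1&1&0\\0&i&-i&0\\1&0&0&-1\end{pmatrix}$; every proper orthochronous Lorentz transformation arises in this way from some $A$ with $\det A=1$, unique up to sign. The concurrence of a state $\rho$ is $\max(0,\tau_1-\tau_2-\tau_3-\tau_4)$, where $\tau_1\ge\tau_2\ge\tau_3\ge\tau_4$ are the singular values of $X^T(\sigma_y\otimes\sigma_y)X$ for any square matrix $X$ with $\rho=XX^\dagger$ (the value does not depend on the choice of $X$). A Bell diagonal state is a density matrix that is diagonal in the Bell basis $\frac{1}{\sqrt2}(|00\rangle\pm|11\rangle)$, $\frac1{\sqrt2}(|01\rangle\pm|10\rangle)$. *)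

theory Defs
  imports Jordan_Normal_Form.Schur_Decomposition Jordan_Normal_Form.DL_Rank
begin

(* Basis vectors of the tensor product C^2 (x) C^2 are ordered |00>, |01>, |10>, |11>. *)

definition kron :: "'a :: semiring_0 mat \<Rightarrow> 'a mat \<Rightarrow> 'a mat" where
  "kron A B = Matrix.mat (dim_row A * dim_row B) (dim_col A * dim_col B)
     (\<lambda>(i, j). A $$ (i div dim_row B, j div dim_col B) * B $$ (i mod dim_row B, j mod dim_col B))"

definition mat_trace :: "'a :: comm_monoid_add mat \<Rightarrow> 'a" where
  "mat_trace A = (\<Sum>i<dim_row A. A $$ (i, i))"

definition psd :: "nat \<Rightarrow> complex mat \<Rightarrow> bool" where
  "psd n A \<longleftrightarrow> A \<in> carrier_mat n n \<and> mat_adjoint A = A \<and>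
     (\<forall>v \<in> carrier_vec n. 0 \<le> Re ((A *\<^sub>v v) \<bullet>c v))"

definition two_qubit_density :: "complex mat \<Rightarrow> bool" where
  "two_qubit_density \<rho> \<longleftrightarrow> psd 4 \<rho> \<and> mat_trace \<rho> = 1"

definition pauli :: "nat \<Rightarrow> complex mat" where
  "pauli i = mat_of_rows_list 2
     ([[[1, 0], [0, 1]],
       [[0, 1], [1, 0]],
       [[0, - \<i>], [\<i>, 0]],
       [[1, 0], [0, - 1]]] ! i)"

text \<open>Lorentz transformations and their \<open>2 \<times> 2\<close> spinor representatives\<close>

definition minkowski :: "real mat" where
  "minkowski = mat_diag 4 (\<lambda>i. if i = 0 then 1 else - 1)"

definition proper_orthochronous :: "real mat \<Rightarrow> bool" where
  "proper_orthochronous L \<longleftrightarrow> L \<in> carrier_mat 4 4 \<and>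
     L * minkowski * transpose_mat L = minkowski \<and> Determinant.det L = 1 \<and> L $$ (0, 0) > 0"

definition T_mat :: "complex mat" where
  "T_mat = complex_of_real (1 / sqrt 2) \<cdot>\<^sub>m mat_of_rows_list 4
     [[1, 0, 0, 1],
      [0, 1, 1, 0],
      [0, \<i>, - \<i>, 0],
      [1, 0, 0, - 1]]"

definition lorentz_of :: "complex mat \<Rightarrow> complex mat" where
  "lorentz_of A = (1 / complex_of_real (cmod (Determinant.det A))) \<cdot>\<^sub>m
     (T_mat * kron A (map_mat cnj A) * mat_adjoint T_mat)"

(* lorentz_of A has real entries, but is a complex matrix by type; hence the embedding of L. *)
definition corresponds_to :: "complex mat \<Rightarrow> real mat \<Rightarrow> bool" where
  "corresponds_to A L \<longleftrightarrow> A \<in> carrier_mat 2 2 \<and> Determinant.det A \<noteq> 0 \<and>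
     map_mat complex_of_real L = lorentz_of A"

text \<open>Singular values (with multiplicity, in decreasing order) and concurrence\<close>

(* proots is the multiset of roots; the eigenvalues of A^dagger A are real and nonnegative. *)
definition singular_values :: "complex mat \<Rightarrow> real list" where
  "singular_values A = rev (sorted_list_of_multiset
     (image_mset (\<lambda>z. sqrt (Re z)) (proots (char_poly (mat_adjoint A * A)))))"

(* The value does not depend on which factor X of \<rho> is chosen. *)
definition concurrence :: "complex mat \<Rightarrow> real" where
  "concurrence \<rho> =
     (let X = (SOME X. X \<in> carrier_mat 4 4 \<and> \<rho> = X * mat_adjoint X);
          \<tau> = singular_values (transpose_mat X * kron (pauli 2) (pauli 2) * X)
      in max 0 (\<tau> ! 0 - \<tau> ! 1 - \<tau> ! 2 - \<tau> ! 3))"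

text \<open>Local filtering operations\<close>

definition filter_op :: "complex mat \<Rightarrow> bool" where
  "filter_op A \<longleftrightarrow> A \<in> carrier_mat 2 2 \<and> psd 2 (1\<^sub>m 2 - mat_adjoint A * A) \<and>
     Determinant.det A \<noteq> 0"

definition filtered :: "complex mat \<Rightarrow> complex mat \<Rightarrow> complex mat \<Rightarrow> complex mat" where
  "filtered A B \<rho> =
     (let \<rho>' = kron A B * \<rho> * mat_adjoint (kron A B) in (1 / mat_trace \<rho>') \<cdot>\<^sub>m \<rho>')"

definition filtered_states :: "complex mat \<Rightarrow> complex mat set" where
  "filtered_states \<rho> = {filtered A B \<rho> | A B. filter_op A \<and> filter_op B}"

definition normalize_op :: "complex mat \<Rightarrow> complex mat" where
  "normalize_op A = complex_of_real (1 / (singular_values A ! 0)) \<cdot>\<^sub>m A"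

text \<open>Bell diagonal states\<close>

(* The columns are the four Bell vectors. *)
definition bell_basis :: "complex mat" where
  "bell_basis = complex_of_real (1 / sqrt 2) \<cdot>\<^sub>m mat_of_rows_list 4
     [[1, 1, 0, 0],
      [0, 0, 1, 1],
      [0, 0, 1, - 1],
      [1, - 1, 0, 0]]"

definition bell_diagonal_state :: "complex mat \<Rightarrow> bool" where
  "bell_diagonal_state \<rho> \<longleftrightarrow> two_qubit_density \<rho> \<and>
     diagonal_mat (mat_adjoint bell_basis * \<rho> * bell_basis)"

definition rho_Sigma :: "(nat \<Rightarrow> real) \<Rightarrow> complex mat" where
  "rho_Sigma s = complex_of_real (1 / (4 * s 0)) \<cdot>\<^sub>m
     (complex_of_real (s 0) \<cdot>\<^sub>m kron (pauli 0) (pauli 0) +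
      complex_of_real (s 1) \<cdot>\<^sub>m kron (pauli 1) (pauli 1) +
      complex_of_real (s 2) \<cdot>\<^sub>m kron (pauli 2) (pauli 2) +
      complex_of_real (s 3) \<cdot>\<^sub>m kron (pauli 3) (pauli 3))"

end

theory Submission
  imports Defs
begin

text \<open>A filter \<open>A \<otimes> B\<close> acts on the matrix \<open>R\<close> of Pauli coefficients by
  \<open>R \<mapsto> |det A| |det B| L\<^sub>A R L\<^sub>B\<^sup>T\<close>, so the spinors of \<open>L\<^sub>1\<^sup>-\<^sup>1\<close> and \<open>L\<^sub>2\<^sup>-\<^sup>1\<close> filter
  \<open>\<rho>\<close> to \<open>\<rho>\<^sub>\<Sigma>\<close>. Since \<open>(A \<otimes> B)\<^sup>T (\<sigma>\<^sub>y \<otimes> \<sigma>\<^sub>y) (A \<otimes> B) = det A det B (\<sigma>\<^sub>y \<otimes> \<sigma>\<^sub>y)\<close>,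
  filtering multiplies the concurrence by \<open>|det A| |det B|\<close> divided by the trace of the
  unnormalized state, that is, by \<open>1 / (L\<^sub>A R L\<^sub>B\<^sup>T)\<^sub>0\<^sub>0\<close>. With \<open>x\<close> and \<open>y\<close> the top rows of
  \<open>L\<^sub>A L\<^sub>1\<close> and \<open>L\<^sub>B L\<^sub>2\<close>, which are unit timelike and future directed, this corner entry is
  \<open>\<Sum> s\<^sub>i x\<^sub>i y\<^sub>i \<ge> s\<^sub>0\<close>, and \<open>\<rho>\<^sub>\<Sigma>\<close> attains the bound. No spectral theorem is needed to factor
  \<open>\<rho>\<close> as \<open>X X\<^sup>\<dagger>\<close>: it is a congruence transform of \<open>\<rho>\<^sub>\<Sigma>\<close>, which the Bell basis diagonalizes.\<close>

section \<open>Adjoints and positive semidefinite matrices\<close>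

text \<open>The bound on the corner entry is a reversed Cauchy-Schwarz inequality: boosting away
  from the frame in which \<open>R\<close> is diagonal can only enlarge the trace per unit of
  determinant. The longest part of the argument shows that the spinors of the two inverse Lorentz
  matrices exist. Under a Lorentz matrix the projectors |0><0| and |1><1| go to null future vectors,
  hence to rank one matrices built from two spinors a and b. These are fixed only up to phases, and
  the image of |0><1| supplies the relative phase, but it leaves open whether the map is a spinor
  action or such an action composed with a reflection. Determinant one settles this. Positivity and
  rank of \<open>rho_Sigma s\<close> are never read off from the numbers \<open>s i\<close>; both
  are inherited from \<open>\<rho>\<close> through congruence by an invertible matrix.\<close>

lemma adjoint_index:
  fixes A :: "complex mat"
  assumes "i < dim_col A" "j < dim_row A"
  shows "mat_adjoint A $$ (i, j) = cnj (A $$ (j, i))"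
  using assms by (simp add: mat_adjoint_def mat_of_rows_def conjugate_complex_def)

lemma adjoint_dim [simp]:
  fixes A :: "'a :: conjugatable_field mat"
  shows "dim_row (mat_adjoint A) = dim_col A" "dim_col (mat_adjoint A) = dim_row A"
  by (simp_all add: mat_adjoint_def)

lemma adjoint_carrier [simp, intro]:
  fixes A :: "'a :: conjugatable_field mat"
  shows "A \<in> carrier_mat m n \<Longrightarrow> mat_adjoint A \<in> carrier_mat n m"
  by auto

lemma adjoint_eq_transpose:
  fixes A :: "complex mat"
  shows "mat_adjoint A = transpose_mat (map_mat cnj A)"
  by (rule eq_matI) (simp_all add: adjoint_index)

lemma map_cnj_mult:
  fixes A B :: "complex mat"
  assumes "A \<in> carrier_mat n m" "B \<in> carrier_mat m k"
  shows "map_mat cnj (A * B) = map_mat cnj A * map_mat cnj B"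
  using assms by (intro eq_matI) (auto simp: scalar_prod_def)

lemma adjoint_mult:
  fixes A B :: "complex mat"
  assumes "A \<in> carrier_mat n m" "B \<in> carrier_mat m k"
  shows "mat_adjoint (A * B) = mat_adjoint B * mat_adjoint A"
  unfolding adjoint_eq_transpose map_cnj_mult[OF assms]
  by (rule transpose_mult) (use assms in auto)

lemma adjoint_smult:
  fixes A :: "complex mat"
  shows "mat_adjoint (c \<cdot>\<^sub>m A) = cnj c \<cdot>\<^sub>m mat_adjoint A"
  by (rule eq_matI) (simp_all add: adjoint_index)

lemma adjoint_adjoint [simp]:
  fixes A :: "complex mat"
  shows "mat_adjoint (mat_adjoint A) = A"
  by (rule eq_matI) (simp_all add: adjoint_index)

lemma cscalar_adjoint:
  fixes A :: "complex mat"
  assumes "A \<in> carrier_mat n m" "v \<in> carrier_vec m" "w \<in> carrier_vec n"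
  shows "(A *\<^sub>v v) \<bullet>c w = v \<bullet>c (mat_adjoint A *\<^sub>v w)"
proof -
  have "(A *\<^sub>v v) \<bullet>c w = (\<Sum>i<n. \<Sum>j<m. A $$ (i,j) * v $ j * cnj (w $ i))"
    using assms by (simp add: scalar_prod_def conjugate_complex_def sum_distrib_right atLeast0LessThan)
  also have "\<dots> = (\<Sum>j<m. \<Sum>i<n. A $$ (i,j) * v $ j * cnj (w $ i))"
    by (rule sum.swap)
  also have "\<dots> = v \<bullet>c (mat_adjoint A *\<^sub>v w)"
    using assms by (simp add: scalar_prod_def conjugate_complex_def sum_distrib_left atLeast0LessThan
      adjoint_index mult_ac)
  finally show ?thesis .
qed

lemma psd_congruence:
  assumes "psd n A" "K \<in> carrier_mat m n"
  shows "psd m (K * A * mat_adjoint K)"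
proof -
  from assms have A: "A \<in> carrier_mat n n" and h: "mat_adjoint A = A"
    and p: "\<And>v. v \<in> carrier_vec n \<Longrightarrow> 0 \<le> Re ((A *\<^sub>v v) \<bullet>c v)" by (auto simp: psd_def)
  note K = assms(2)
  have KA: "K * A \<in> carrier_mat m n" using K A by simp
  have "mat_adjoint (K * A * mat_adjoint K) = K * A * mat_adjoint K"
    using K A h adjoint_mult[OF KA, of "mat_adjoint K" m] adjoint_mult[OF K A]
      assoc_mult_mat[of K m n A n "mat_adjoint K" m] by simp
  moreover have "0 \<le> Re ((K * A * mat_adjoint K *\<^sub>v v) \<bullet>c v)" if v: "v \<in> carrier_vec m" for v
  proof -
    have w: "mat_adjoint K *\<^sub>v v \<in> carrier_vec n"
      using K v by (intro mult_mat_vec_carrier[OF adjoint_carrier[OF K]])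
    have "K * A * mat_adjoint K *\<^sub>v v = K *\<^sub>v (A *\<^sub>v (mat_adjoint K *\<^sub>v v))"
      using K A v w
      by (simp add: assoc_mult_mat_vec[of _ m n] assoc_mult_mat_vec[of _ m n "mat_adjoint K" m])
    then show ?thesis
      using cscalar_adjoint[OF K, of "A *\<^sub>v (mat_adjoint K *\<^sub>v v)" v] p[OF w] A v w by simp
  qed
  ultimately show ?thesis using K A by (auto simp: psd_def)
qed

lemma psd_smult:
  assumes "psd n A" "0 \<le> c"
  shows "psd n (complex_of_real c \<cdot>\<^sub>m A)"
proof -
  from assms have A: "A \<in> carrier_mat n n" by (auto simp: psd_def)
  have "(complex_of_real c \<cdot>\<^sub>m A *\<^sub>v v) \<bullet>c v = complex_of_real c * ((A *\<^sub>v v) \<bullet>c v)"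
    if "v \<in> carrier_vec n" for v
    using A that by (simp add: scalar_prod_def row_def sum_distrib_left mult_ac)
  with assms show ?thesis by (auto simp: psd_def adjoint_smult)
qed

section \<open>Explicit small matrices, Kronecker products and reshuffling\<close>

lemma sum_upto_2: "(\<Sum>i\<in>{0..<2}. f i) = f 0 + f (1::nat)" for f :: "nat \<Rightarrow> 'a :: comm_monoid_add"
  by (simp add: numeral_eq_Suc)

lemma sum_upto_4: "(\<Sum>i\<in>{0..<4}. f i) = f 0 + f 1 + f 2 + f (3::nat)"
  for f :: "nat \<Rightarrow> 'a :: comm_monoid_add"
  by (simp add: numeral_eq_Suc add.assoc)

lemma less_2_iff: "i < 2 \<longleftrightarrow> i = 0 \<or> i = (1::nat)"
  by auto

lemma less_4_iff: "i < 4 \<longleftrightarrow> i = 0 \<or> i = 1 \<or> i = 2 \<or> i = (3::nat)"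
  by auto

lemma mult_index_2:
  fixes A B :: "'a :: comm_semiring_0 mat"
  assumes "A \<in> carrier_mat n 2" "B \<in> carrier_mat 2 m" "i < n" "j < m"
  shows "(A * B) $$ (i, j) = A $$ (i,0) * B $$ (0,j) + A $$ (i,1) * B $$ (1,j)"
  using assms by (simp add: scalar_prod_def sum_upto_2)

lemma mult_index_4:
  fixes A B :: "'a :: comm_semiring_0 mat"
  assumes "A \<in> carrier_mat n 4" "B \<in> carrier_mat 4 m" "i < n" "j < m"
  shows "(A * B) $$ (i, j) = A $$ (i,0) * B $$ (0,j) + A $$ (i,1) * B $$ (1,j)
    + A $$ (i,2) * B $$ (2,j) + A $$ (i,3) * B $$ (3,j)"
  using assms by (simp add: scalar_prod_def sum_upto_4)

text \<open>Otherwise the simplifier unfolds entries of products to scalar products of rows and columns before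
  \<open>mult_index_2\<close> and \<open>mult_index_4\<close> can apply.\<close>

declare index_mult_mat(1) [simp del]

lemma mult_carrier_4 [simp]:
  "A \<in> carrier_mat 4 4 \<Longrightarrow> B \<in> carrier_mat 4 4 \<Longrightarrow> A * B \<in> carrier_mat 4 4"
  by (rule mult_carrier_mat)

lemma mult_carrier_2 [simp]:
  "A \<in> carrier_mat 2 2 \<Longrightarrow> B \<in> carrier_mat 2 2 \<Longrightarrow> A * B \<in> carrier_mat 2 2"
  by (rule mult_carrier_mat)

lemma transpose_index:
  "A \<in> carrier_mat n m \<Longrightarrow> i < m \<Longrightarrow> j < n \<Longrightarrow> transpose_mat A $$ (i, j) = A $$ (j, i)"
  by auto

lemma adjoint_index_carrier:
  fixes A :: "complex mat"
  shows "A \<in> carrier_mat n m \<Longrightarrow> i < m \<Longrightarrow> j < n \<Longrightarrow> mat_adjoint A $$ (i, j) = cnj (A $$ (j, i))"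
  by (auto simp: adjoint_index)

abbreviation mat_2 :: "'a \<Rightarrow> 'a \<Rightarrow> 'a \<Rightarrow> 'a \<Rightarrow> 'a mat" where
  "mat_2 a b c d \<equiv> mat_of_rows_list 2 [[a, b], [c, d]]"

lemma mat_2_carrier [simp, intro]: "mat_2 a b c d \<in> carrier_mat 2 2"
  by (rule carrier_matI) (simp_all add: mat_of_rows_list_def)

lemma mat_2_dim [simp]: "dim_row (mat_2 a b c d) = 2" "dim_col (mat_2 a b c d) = 2"
  by (simp_all add: mat_of_rows_list_def)

lemma mat_2_index [simp]:
  "mat_2 a b c d $$ (0,0) = a" "mat_2 a b c d $$ (0,Suc 0) = b"
  "mat_2 a b c d $$ (Suc 0,0) = c" "mat_2 a b c d $$ (Suc 0,Suc 0) = d"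
  by (simp_all add: mat_of_rows_list_def)

lemma mat_eqI_2:
  assumes "A \<in> carrier_mat 2 2" "B \<in> carrier_mat 2 2"
    and "A $$ (0,0) = B $$ (0,0)" "A $$ (0,1) = B $$ (0,1)"
    and "A $$ (1,0) = B $$ (1,0)" "A $$ (1,1) = B $$ (1,1)"
  shows "A = B"
  using assms by (intro eq_matI) (auto simp: less_2_iff)

lemma mat_eqI_4:
  assumes "A \<in> carrier_mat 4 4" "B \<in> carrier_mat 4 4"
    and "A $$ (0,0) = B $$ (0,0)" "A $$ (0,1) = B $$ (0,1)" "A $$ (0,2) = B $$ (0,2)" "A $$ (0,3) = B $$ (0,3)"
    and "A $$ (1,0) = B $$ (1,0)" "A $$ (1,1) = B $$ (1,1)" "A $$ (1,2) = B $$ (1,2)" "A $$ (1,3) = B $$ (1,3)"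
    and "A $$ (2,0) = B $$ (2,0)" "A $$ (2,1) = B $$ (2,1)" "A $$ (2,2) = B $$ (2,2)" "A $$ (2,3) = B $$ (2,3)"
    and "A $$ (3,0) = B $$ (3,0)" "A $$ (3,1) = B $$ (3,1)" "A $$ (3,2) = B $$ (3,2)" "A $$ (3,3) = B $$ (3,3)"
  shows "A = B"
  by (rule eq_matI) (use assms in \<open>auto simp: less_4_iff\<close>)

lemma det_2:
  fixes A :: "'a :: comm_ring_1 mat"
  assumes "A \<in> carrier_mat 2 2"
  shows "Determinant.det A = A $$ (0,0) * A $$ (1,1) - A $$ (0,1) * A $$ (1,0)"
proof -
  have d: "Determinant.det (mat_delete A i 0) = mat_delete A i 0 $$ (0,0)" for i
    using assms by (intro det_single) auto
  show ?thesis
    unfolding laplace_expansion_column[OF assms, of 0, simplified]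
    using assms by (simp add: cofactor_def d lessThan_atLeast0 sum_upto_2) (simp add: mat_delete_def)
qed

lemma kron_carrier [simp, intro]:
  "A \<in> carrier_mat a b \<Longrightarrow> B \<in> carrier_mat c d \<Longrightarrow> kron A B \<in> carrier_mat (a * c) (b * d)"
  by (auto simp: kron_def)

lemma kron_carrier_2 [simp, intro]:
  "A \<in> carrier_mat 2 2 \<Longrightarrow> B \<in> carrier_mat 2 2 \<Longrightarrow> kron A B \<in> carrier_mat 4 4"
  using kron_carrier[of A 2 2 B 2 2] by simp

lemma kron_index:
  assumes "A \<in> carrier_mat 2 2" "B \<in> carrier_mat 2 2" "i < 4" "j < 4"
  shows "kron A B $$ (i, j) = A $$ (i div 2, j div 2) * B $$ (i mod 2, j mod 2)"
  using assms by (simp add: kron_def)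

lemma kron_smult:
  assumes "A \<in> carrier_mat 2 2" "B \<in> carrier_mat 2 2"
  shows "kron (a \<cdot>\<^sub>m A) (b \<cdot>\<^sub>m B) = (a * b :: complex) \<cdot>\<^sub>m kron A B"
  using assms by (intro eq_matI) (auto simp: kron_def mult_ac)

lemma pauli_carrier [simp, intro]: "i < 4 \<Longrightarrow> pauli i \<in> carrier_mat 2 2"
  by (auto simp: pauli_def mat_of_rows_list_def less_4_iff)

lemma kron_dim [simp]:
  "dim_row (kron A B) = dim_row A * dim_row B" "dim_col (kron A B) = dim_col A * dim_col B"
  by (simp_all add: kron_def)

lemma pauli_dim [simp]: "i < 4 \<Longrightarrow> dim_row (pauli i) = 2" "i < 4 \<Longrightarrow> dim_col (pauli i) = 2"
  using carrier_matD[OF pauli_carrier] by blast+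

lemma pauli_index:
  "pauli 0 $$ (0,0) = 1" "pauli 0 $$ (0,1) = 0" "pauli 0 $$ (1,0) = 0" "pauli 0 $$ (1,1) = 1"
  "pauli 1 $$ (0,0) = 0" "pauli 1 $$ (0,1) = 1" "pauli 1 $$ (1,0) = 1" "pauli 1 $$ (1,1) = 0"
  "pauli 2 $$ (0,0) = 0" "pauli 2 $$ (0,1) = - \<i>" "pauli 2 $$ (1,0) = \<i>" "pauli 2 $$ (1,1) = 0"
  "pauli 3 $$ (0,0) = 1" "pauli 3 $$ (0,1) = 0" "pauli 3 $$ (1,0) = 0" "pauli 3 $$ (1,1) = - 1"
  by (simp_all add: pauli_def mat_of_rows_list_def)

section \<open>The spin flip\<close>

lemma spin_flip_eq:
  "kron (pauli 2) (pauli 2) = Matrix.mat 4 4 (\<lambda>(i, j).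
     if i + j = 3 then if i = 0 \<or> i = 3 then -1 else 1 else 0)"
  by (rule mat_eqI_4) (simp_all add: kron_index pauli_index[simplified])

lemma spin_flip_square: "kron (pauli 2) (pauli 2) * kron (pauli 2) (pauli 2) = 1\<^sub>m 4"
  unfolding spin_flip_eq by (rule mat_eqI_4) (simp_all add: mult_index_4[of _ 4 _ 4])

text \<open>On each factor \<open>transpose_mat A * pauli 2 * A\<close> is antisymmetric, so it is a
  multiple of \<open>pauli 2\<close>, and the multiple is the determinant of
  \<open>A\<close>.\<close>

lemma kron_spin_flip:
  fixes A B :: "complex mat"
  assumes "A \<in> carrier_mat 2 2" "B \<in> carrier_mat 2 2"
  shows "transpose_mat (kron A B) * kron (pauli 2) (pauli 2) * kron A B
    = (Determinant.det A * Determinant.det B) \<cdot>\<^sub>m kron (pauli 2) (pauli 2)"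
  unfolding spin_flip_eq
  by (rule mat_eqI_4)
    (use assms in \<open>simp_all add: mult_index_4[of _ 4 _ 4] transpose_index[of _ 4 4] kron_index det_2 algebra_simps\<close>)

lemma smult_smult_mat: "a \<cdot>\<^sub>m (b \<cdot>\<^sub>m A) = (a * b :: 'a :: semigroup_mult) \<cdot>\<^sub>m A"
  by (rule eq_matI) (simp_all add: mult.assoc)

lemma transpose_smult_mat: "transpose_mat (c \<cdot>\<^sub>m A) = c \<cdot>\<^sub>m transpose_mat A"
  by (rule eq_matI) simp_all

text \<open>Regards \<open>\<rho>\<close> as the matrix of the map \<open>|j\<rangle>\<langle>j'| \<mapsto> |i\<rangle>\<langle>i'|\<close>: this turns a local filter
  \<open>A \<otimes> B\<close> into left and right multiplication by \<open>A \<otimes> A\<^sup>*\<close> and \<open>(B \<otimes> B\<^sup>*)\<^sup>T\<close>.\<close>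

definition reshuffle :: "'a mat \<Rightarrow> 'a mat" where
  "reshuffle \<rho> = Matrix.mat 4 4
     (\<lambda>(i, j). \<rho> $$ (2 * (i div 2) + j div 2, 2 * (i mod 2) + j mod 2))"

lemma reshuffle_carrier [simp, intro]: "reshuffle \<rho> \<in> carrier_mat 4 4"
  by (simp add: reshuffle_def)

lemma reshuffle_dim [simp]: "dim_row (reshuffle \<rho>) = 4" "dim_col (reshuffle \<rho>) = 4"
  by (simp_all add: reshuffle_def)

lemma reshuffle_index:
  "i < 4 \<Longrightarrow> j < 4 \<Longrightarrow>
    reshuffle \<rho> $$ (i, j) = \<rho> $$ (2 * (i div 2) + j div 2, 2 * (i mod 2) + j mod 2)"
  by (simp add: reshuffle_def)

lemma reshuffle_reshuffle: "\<rho> \<in> carrier_mat 4 4 \<Longrightarrow> reshuffle (reshuffle \<rho>) = \<rho>"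
  by (rule mat_eqI_4) (simp_all add: reshuffle_def, simp_all add: numeral_eq_Suc)

lemma reshuffle_smult: "\<rho> \<in> carrier_mat 4 4 \<Longrightarrow> reshuffle (c \<cdot>\<^sub>m \<rho>) = c \<cdot>\<^sub>m reshuffle \<rho>"
  by (rule eq_matI) (auto simp: reshuffle_def less_4_iff)

text \<open>Each entry of the left side is a sum of terms A_(ac) B_(bd) \<rho>_(cd,c'd') cnj
  A_(a'c') cnj B_(b'd'). Grouping the indices as (a,a'), (c,c'), (d,d'), (b,b') instead of ket
  against bra turns it into a product of three matrices.\<close>

lemma reshuffle_kron:
  fixes A B :: "complex mat"
  assumes A: "A \<in> carrier_mat 2 2" and B: "B \<in> carrier_mat 2 2" and \<rho>: "\<rho> \<in> carrier_mat 4 4"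
  shows "reshuffle (kron A B * \<rho> * mat_adjoint (kron A B))
    = kron A (map_mat cnj A) * reshuffle \<rho> * transpose_mat (kron B (map_mat cnj B))"
    (is "?l = ?r")
proof (rule eq_matI)
  fix i j assume "i < dim_row ?r" "j < dim_col ?r"
  then have ij: "i < 4" "j < 4" using B A by (auto simp: kron_def)
  \<comment> \<open>Both indices are split into their two binary digits, which are the tensor
    indices.\<close>
  define a a' b b' where "a = i div 2" and "a' = i mod 2" and "b = j div 2" and "b' = j mod 2"
  have i: "i = 2 * a + a'" and j: "j = 2 * b + b'" and lt: "a < 2" "a' < 2" "b < 2" "b' < 2"
    using ij by (auto simp: a_def a'_def b_def b'_def)
  have lt4: "2 * a + b < 4" "2 * a' + b' < 4" "2 * a + a' < 4" "2 * b + b' < 4" using lt by auto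
  have K: "kron A B \<in> carrier_mat 4 4" "kron A (map_mat cnj A) \<in> carrier_mat 4 4"
      "kron B (map_mat cnj B) \<in> carrier_mat 4 4"
    using A B by auto
  have cA: "map_mat cnj A \<in> carrier_mat 2 2" and cB: "map_mat cnj B \<in> carrier_mat 2 2" using A B by auto
  have "?l $$ (i,j) = (kron A B * \<rho> * mat_adjoint (kron A B)) $$ (2 * a + b, 2 * a' + b')"
    using ij by (simp add: reshuffle_def a_def a'_def b_def b'_def)
  also have "\<dots> = ?r $$ (2 * a + a', 2 * b + b')"
    using lt lt4 A B cA cB K \<rho>
    by (simp add: mult_index_4[of _ 4 _ 4] transpose_index[of _ 4 4] kron_index adjoint_index_carrier[of _ 4 4] reshuffle_def div_add1_eq
     ) (simp add: algebra_simps numeral_2_eq_2 numeral_3_eq_3)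
  finally show "?l $$ (i,j) = ?r $$ (i,j)" by (simp only: i j)
qed (use A B in \<open>auto simp: kron_def reshuffle_def\<close>)

section \<open>The change of basis between matrix units and Pauli matrices\<close>

lemma T_carrier [simp, intro]: "T_mat \<in> carrier_mat 4 4"
  by (auto simp: T_mat_def mat_of_rows_list_def)

lemma T_dim [simp]: "dim_row T_mat = 4" "dim_col T_mat = 4"
  by (simp_all add: T_mat_def mat_of_rows_list_def)

text \<open>Kept as an opaque constant, so that simplification uses only its square and its reality
  and never meets the square root.\<close>

definition rsqrt2 :: complex where "rsqrt2 = complex_of_real (1 / sqrt 2)"

lemma rsqrt2_square: "rsqrt2 * rsqrt2 = 1 / 2" "rsqrt2 * (rsqrt2 * x) = x / 2" "cnj rsqrt2 = rsqrt2"
proof -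
  show s: "rsqrt2 * rsqrt2 = 1 / 2"
    unfolding rsqrt2_def of_real_mult[symmetric] by simp
  show "rsqrt2 * (rsqrt2 * x) = x / 2" by (simp add: mult.assoc[symmetric] s)
qed (simp add: rsqrt2_def)

lemma T_index:
  "T_mat $$ (0,0) = rsqrt2" "T_mat $$ (0,1) = 0" "T_mat $$ (0,2) = 0" "T_mat $$ (0,3) = rsqrt2"
  "T_mat $$ (1,0) = 0" "T_mat $$ (1,1) = rsqrt2" "T_mat $$ (1,2) = rsqrt2" "T_mat $$ (1,3) = 0"
  "T_mat $$ (2,0) = 0" "T_mat $$ (2,1) = rsqrt2 * \<i>" "T_mat $$ (2,2) = - (rsqrt2 * \<i>)" "T_mat $$ (2,3) = 0"
  "T_mat $$ (3,0) = rsqrt2" "T_mat $$ (3,1) = 0" "T_mat $$ (3,2) = 0" "T_mat $$ (3,3) = - rsqrt2"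
  by (simp_all add: T_mat_def mat_of_rows_list_def rsqrt2_def)

lemmas T_simps = mult_index_4[of _ 4 _ 4] T_index[simplified] adjoint_index_carrier[of _ 4 4] rsqrt2_square

lemma T_unitary: "T_mat * mat_adjoint T_mat = 1\<^sub>m 4" "mat_adjoint T_mat * T_mat = 1\<^sub>m 4"
proof -
  show "T_mat * mat_adjoint T_mat = 1\<^sub>m 4"
    by (rule mat_eqI_4) (auto simp: T_simps)
  then show "mat_adjoint T_mat * T_mat = 1\<^sub>m 4"
    by (rule mat_mult_left_right_inverse[rotated 2]) auto
qed

text \<open>The operator with Pauli coefficients \<open>R\<close>, that is, \<open>\<Sum> R\<^sub>i\<^sub>j \<sigma>\<^sub>i \<otimes> \<sigma>\<^sub>j / 4\<close>.\<close>

definition of_pauli_coeffs :: "complex mat \<Rightarrow> complex mat" where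
  "of_pauli_coeffs R = reshuffle ((1 / 2) \<cdot>\<^sub>m (mat_adjoint T_mat * R * map_mat cnj T_mat))"

lemma of_pauli_coeffs_carrier [simp, intro]: "of_pauli_coeffs R \<in> carrier_mat 4 4"
  by (simp add: of_pauli_coeffs_def)

lemma T_transpose: "transpose_mat T_mat * map_mat cnj T_mat = 1\<^sub>m 4"
  "map_mat cnj T_mat * transpose_mat T_mat = 1\<^sub>m 4"
proof -
  have "transpose_mat (mat_adjoint T_mat * T_mat) = transpose_mat T_mat * map_mat cnj T_mat"
    by (subst transpose_mult[of _ 4 4 _ 4]) (auto simp: adjoint_eq_transpose)
  then show "transpose_mat T_mat * map_mat cnj T_mat = 1\<^sub>m 4" by (simp add: T_unitary)
  then show "map_mat cnj T_mat * transpose_mat T_mat = 1\<^sub>m 4"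
    by (rule mat_mult_left_right_inverse[rotated 2]) auto
qed

section \<open>Action of local filters on Pauli coefficients\<close>

lemmas assoc_mult_4 = assoc_mult_mat[of _ 4 4 _ 4 _ 4]

lemmas one_mult_4 = left_mult_one_mat[of _ 4 4] right_mult_one_mat[of _ 4 4]

lemma smult_mult_4:
  fixes A B :: "'a :: comm_ring_1 mat"
  assumes "A \<in> carrier_mat 4 4" "B \<in> carrier_mat 4 4"
  shows "(c \<cdot>\<^sub>m A) * B = c \<cdot>\<^sub>m (A * B)" "A * (c \<cdot>\<^sub>m B) = c \<cdot>\<^sub>m (A * B)"
  by (rule mult_smult_assoc_mat[OF assms], rule mult_smult_distrib[OF assms])

lemma lorentz_of_carrier [simp, intro]: "lorentz_of A \<in> carrier_mat 4 4"
  by (rule carrier_matI) (simp_all add: lorentz_of_def T_mat_def mat_of_rows_list_def)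

text \<open>Unitarity of \<open>T_mat\<close> moves it past the Lorentz factors: the adjoint of
  \<open>T_mat\<close> times \<open>lorentz_of A\<close> is A tensor cnj A times that adjoint, up to
  1 / |det A|, and similarly on the right. What remains is \<open>reshuffle_kron\<close>.\<close>

lemma of_pauli_coeffs_filter:
  assumes A: "A \<in> carrier_mat 2 2" "Determinant.det A \<noteq> 0"
    and B: "B \<in> carrier_mat 2 2" "Determinant.det B \<noteq> 0" and R: "R \<in> carrier_mat 4 4"
  shows "kron A B * of_pauli_coeffs R * mat_adjoint (kron A B)
    = complex_of_real (cmod (Determinant.det A) * cmod (Determinant.det B)) \<cdot>\<^sub>m
      of_pauli_coeffs (lorentz_of A * R * transpose_mat (lorentz_of B))"
proof -
  define KA KB where "KA = kron A (map_mat cnj A)" and "KB = kron B (map_mat cnj B)"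
  define nA nB where "nA = complex_of_real (cmod (Determinant.det A))"
    and "nB = complex_of_real (cmod (Determinant.det B))"
  have n0: "nA \<noteq> 0" "nB \<noteq> 0" using A B by (auto simp: nA_def nB_def)
  have K [simp]: "KA \<in> carrier_mat 4 4" "KB \<in> carrier_mat 4 4" using A B by (auto simp: KA_def KB_def)
  have [simp]: "mat_adjoint T_mat \<in> carrier_mat 4 4" by auto
  note [simp] = R
  have [simp]: "kron A B \<in> carrier_mat 4 4" "mat_adjoint (kron A B) \<in> carrier_mat 4 4" using A B by auto
  have LA: "lorentz_of A = (1 / nA) \<cdot>\<^sub>m (T_mat * KA * mat_adjoint T_mat)"
    and LB: "lorentz_of B = (1 / nB) \<cdot>\<^sub>m (T_mat * KB * mat_adjoint T_mat)"
    by (simp_all add: lorentz_of_def KA_def KB_def nA_def nB_def)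
  have "mat_adjoint T_mat * (T_mat * KA * mat_adjoint T_mat)
      = (mat_adjoint T_mat * T_mat) * KA * mat_adjoint T_mat" by (simp add: assoc_mult_4)
  then have 1: "mat_adjoint T_mat * lorentz_of A = (1 / nA) \<cdot>\<^sub>m (KA * mat_adjoint T_mat)"
    by (simp add: LA smult_mult_4 T_unitary one_mult_4)
  have "transpose_mat (T_mat * KB * mat_adjoint T_mat)
      = map_mat cnj T_mat * transpose_mat KB * transpose_mat T_mat"
    by (simp add: transpose_mult[of _ 4 4 _ 4] adjoint_eq_transpose assoc_mult_4)
  then have "transpose_mat (lorentz_of B)
      = (1 / nB) \<cdot>\<^sub>m (map_mat cnj T_mat * transpose_mat KB * transpose_mat T_mat)"
    by (simp add: LB transpose_smult_mat)
  then have 2: "transpose_mat (lorentz_of B) * map_mat cnj T_mat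
      = (1 / nB) \<cdot>\<^sub>m (map_mat cnj T_mat * transpose_mat KB)"
    by (simp add: smult_mult_4 assoc_mult_4 T_transpose one_mult_4)
  let ?M = "mat_adjoint T_mat * R * map_mat cnj T_mat"
  have "mat_adjoint T_mat * (lorentz_of A * R * transpose_mat (lorentz_of B)) * map_mat cnj T_mat
      = (mat_adjoint T_mat * lorentz_of A) * R * (transpose_mat (lorentz_of B) * map_mat cnj T_mat)"
    by (simp add: assoc_mult_4)
  also have "\<dots> = (1 / (nA * nB)) \<cdot>\<^sub>m (KA * ?M * transpose_mat KB)"
    unfolding 1 2 by (simp add: smult_mult_4 assoc_mult_4 smult_smult_mat mult.commute)
  finally have 3: "mat_adjoint T_mat * (lorentz_of A * R * transpose_mat (lorentz_of B)) * map_mat cnj T_mat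
      = (1 / (nA * nB)) \<cdot>\<^sub>m (KA * ?M * transpose_mat KB)" .
  have "reshuffle (kron A B * of_pauli_coeffs R * mat_adjoint (kron A B))
     = KA * ((1 / 2) \<cdot>\<^sub>m ?M) * transpose_mat KB"
    using A B by (simp add: reshuffle_kron of_pauli_coeffs_def reshuffle_reshuffle KA_def KB_def)
  also have "\<dots> = (nA * nB) \<cdot>\<^sub>m ((1 / 2) \<cdot>\<^sub>m ((1 / (nA * nB)) \<cdot>\<^sub>m (KA * ?M * transpose_mat KB)))"
    using n0 by (simp add: smult_mult_4 smult_smult_mat)
  also have "\<dots> = reshuffle ((nA * nB) \<cdot>\<^sub>m
      of_pauli_coeffs (lorentz_of A * R * transpose_mat (lorentz_of B)))"
    by (simp add: reshuffle_smult reshuffle_reshuffle of_pauli_coeffs_def 3)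
  \<comment> \<open>\<open>reshuffle\<close> is an involution, so equality after reshuffling
    suffices.\<close>
  finally show ?thesis
    by (metis reshuffle_reshuffle nA_def nB_def of_real_mult of_pauli_coeffs_carrier smult_carrier_mat
      \<open>kron A B \<in> carrier_mat 4 4\<close> \<open>mat_adjoint (kron A B) \<in> carrier_mat 4 4\<close> mult_carrier_4)
qed

text \<open>Up to the factor sqrt 2, row i of \<open>T_mat\<close> lists the entries of the
  transpose of \<open>pauli i\<close>. Hence the traces are the entries of
  \<open>T_mat * reshuffle \<rho> * transpose_mat T_mat\<close> times 2, and unitarity inverts this
  relation.\<close>

lemma of_pauli_coeffs_eqI:
  assumes \<rho>: "\<rho> \<in> carrier_mat 4 4" and R: "R \<in> carrier_mat 4 4"
    and tr: "\<And>i j. i < 4 \<Longrightarrow> j < 4 \<Longrightarrow> R $$ (i, j) = mat_trace (\<rho> * kron (pauli i) (pauli j))"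
  shows "of_pauli_coeffs R = \<rho>"
proof -
  have p: "pauli 0 \<in> carrier_mat 2 2" "pauli (Suc 0) \<in> carrier_mat 2 2"
    "pauli 2 \<in> carrier_mat 2 2" "pauli 3 \<in> carrier_mat 2 2" by auto
  have k: "kron (pauli i) (pauli j) \<in> carrier_mat 4 4" if "i < 4" "j < 4" for i j
    using that by (intro kron_carrier_2 pauli_carrier)
  have "R = 2 \<cdot>\<^sub>m (T_mat * reshuffle \<rho> * transpose_mat T_mat)"
    by (rule mat_eqI_4)
      (use \<rho> R k p in \<open>simp_all add: tr mat_trace_def lessThan_atLeast0 sum_upto_4 T_simps kron_index
        pauli_index[simplified] transpose_index[of _ 4 4] reshuffle_index\<close>,
       simp_all add: algebra_simps rsqrt2_square numeral_2_eq_2 numeral_3_eq_3)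
  then have "mat_adjoint T_mat * R * map_mat cnj T_mat
     = 2 \<cdot>\<^sub>m ((mat_adjoint T_mat * T_mat) * reshuffle \<rho> * (transpose_mat T_mat * map_mat cnj T_mat))"
    by (simp add: smult_mult_4 assoc_mult_4)
  moreover have "1 \<cdot>\<^sub>m reshuffle \<rho> = reshuffle \<rho>" by (rule eq_matI) auto
  ultimately show ?thesis
    using \<rho> by (simp add: of_pauli_coeffs_def T_unitary T_transpose smult_smult_mat reshuffle_reshuffle one_mult_4)
qed

lemma trace_of_pauli_coeffs:
  assumes "R \<in> carrier_mat 4 4"
  shows "mat_trace (of_pauli_coeffs R) = R $$ (0, 0)"
proof -
  have "mat_trace (of_pauli_coeffs R) = rsqrt2 * rsqrt2 * (R $$ (0, 0) + R $$ (0, 0))"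
    using assms
    by (simp add: of_pauli_coeffs_def mat_trace_def lessThan_atLeast0 sum_upto_4 reshuffle_index
      T_simps transpose_index[of _ 4 4] numeral_2_eq_2[symmetric] numeral_3_eq_3[symmetric])
      (simp add: algebra_simps rsqrt2_square, simp add: field_simps)
  then show ?thesis by (simp add: rsqrt2_square)
qed

lemma rho_Sigma_carrier [simp, intro]: "rho_Sigma s \<in> carrier_mat 4 4"
  by (auto simp: rho_Sigma_def intro!: add_carrier_mat smult_carrier_mat kron_carrier_2 pauli_carrier)

lemma rho_Sigma_eq:
  "rho_Sigma s = complex_of_real (1 / (4 * s 0)) \<cdot>\<^sub>m Matrix.mat 4 4 (\<lambda>(i, j).
     if i = j then complex_of_real (if i = 0 \<or> i = 3 then s 0 + s 3 else s 0 - s 3)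
     else if i + j = 3 then complex_of_real (if i = 0 \<or> i = 3 then s 1 - s 2 else s 1 + s 2)
     else 0)"
proof -
  have p: "pauli 0 \<in> carrier_mat 2 2" "pauli (Suc 0) \<in> carrier_mat 2 2"
    "pauli 2 \<in> carrier_mat 2 2" "pauli 3 \<in> carrier_mat 2 2" by auto
  show ?thesis
    unfolding rho_Sigma_def
    by (rule arg_cong[where f = "smult_mat _"], rule mat_eqI_4)
      (use p in \<open>simp_all add: kron_index pauli_index[simplified]\<close>)
qed

lemma of_pauli_coeffs_diag:
  assumes "s 0 \<noteq> 0"
  shows "of_pauli_coeffs (mat_diag 4 (\<lambda>i. complex_of_real (s i))) = complex_of_real (s 0) \<cdot>\<^sub>m rho_Sigma s"
proof -
  have "complex_of_real (s 0) \<cdot>\<^sub>m rho_Sigma s = (1 / 4) \<cdot>\<^sub>m Matrix.mat 4 4 (\<lambda>(i, j).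
     if i = j then complex_of_real (if i = 0 \<or> i = 3 then s 0 + s 3 else s 0 - s 3)
     else if i + j = 3 then complex_of_real (if i = 0 \<or> i = 3 then s 1 - s 2 else s 1 + s 2)
     else 0)" (is "_ = ?r")
    using assms by (simp add: rho_Sigma_eq smult_smult_mat)
  moreover have "of_pauli_coeffs (mat_diag 4 (\<lambda>i. complex_of_real (s i))) = ?r"
    by (rule mat_eqI_4)
      (simp_all add: of_pauli_coeffs_def reshuffle_index T_simps mat_diag_def
         numeral_2_eq_2[symmetric] numeral_3_eq_3[symmetric], simp_all add: algebra_simps rsqrt2_square)
  ultimately show ?thesis by simp
qed

section \<open>Normalization of filters by the largest singular value\<close>

lemma bell_carrier [simp, intro]: "bell_basis \<in> carrier_mat 4 4"
  by (auto simp: bell_basis_def mat_of_rows_list_def)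

lemma bell_index:
  "bell_basis $$ (0,0) = rsqrt2" "bell_basis $$ (0,1) = rsqrt2" "bell_basis $$ (0,2) = 0" "bell_basis $$ (0,3) = 0"
  "bell_basis $$ (1,0) = 0" "bell_basis $$ (1,1) = 0" "bell_basis $$ (1,2) = rsqrt2" "bell_basis $$ (1,3) = rsqrt2"
  "bell_basis $$ (2,0) = 0" "bell_basis $$ (2,1) = 0" "bell_basis $$ (2,2) = rsqrt2" "bell_basis $$ (2,3) = - rsqrt2"
  "bell_basis $$ (3,0) = rsqrt2" "bell_basis $$ (3,1) = - rsqrt2" "bell_basis $$ (3,2) = 0" "bell_basis $$ (3,3) = 0"
  by (simp_all add: bell_basis_def mat_of_rows_list_def rsqrt2_def)

lemma bell_unitary: "bell_basis * mat_adjoint bell_basis = 1\<^sub>m 4" "mat_adjoint bell_basis * bell_basis = 1\<^sub>m 4"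
proof -
  have [simp]: "dim_row bell_basis = 4" "dim_col bell_basis = 4"
    by (simp_all add: bell_basis_def mat_of_rows_list_def)
  show "bell_basis * mat_adjoint bell_basis = 1\<^sub>m 4"
    by (rule mat_eqI_4) (auto simp: mult_index_4[of _ 4 _ 4] bell_index[simplified]
      adjoint_index_carrier[of _ 4 4] rsqrt2_square)
  then show "mat_adjoint bell_basis * bell_basis = 1\<^sub>m 4"
    by (rule mat_mult_left_right_inverse[rotated 2]) auto
qed

section \<open>Gram matrices and singular values of two by two matrices\<close>

lemma gram_2:
  fixes A :: "complex mat"
  assumes "A \<in> carrier_mat 2 2"
  defines "p \<equiv> (cmod (A $$ (0,0)))\<^sup>2 + (cmod (A $$ (1,0)))\<^sup>2"
    and "r \<equiv> (cmod (A $$ (0,1)))\<^sup>2 + (cmod (A $$ (1,1)))\<^sup>2"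
    and "q \<equiv> cnj (A $$ (0,0)) * A $$ (0,1) + cnj (A $$ (1,0)) * A $$ (1,1)"
  shows "mat_adjoint A * A = mat_2 (complex_of_real p) q (cnj q) (complex_of_real r)"
    and "p * r - (cmod q)\<^sup>2 = (cmod (Determinant.det A))\<^sup>2"
proof -
  show "mat_adjoint A * A = mat_2 (complex_of_real p) q (cnj q) (complex_of_real r)"
    using assms(1)
    by (intro mat_eqI_2)
      (simp_all add: mult_index_2[of _ 2 _ 2] adjoint_index_carrier[of _ 2 2]
        p_def q_def r_def complex_norm_square mult.commute del: of_real_power)
  show "p * r - (cmod q)\<^sup>2 = (cmod (Determinant.det A))\<^sup>2"
    unfolding det_2[OF assms(1)] p_def q_def r_def cmod_power2
    by (simp add: power2_eq_square algebra_simps)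
qed

lemma psd_2I:
  fixes a d :: real
  assumes "0 \<le> a" "0 \<le> d" "(cmod b)\<^sup>2 \<le> a * d"
  shows "psd 2 (mat_2 (complex_of_real a) b (cnj b) (complex_of_real d))" (is "psd 2 ?M")
proof -
  have h: "mat_adjoint ?M = ?M"
    by (rule mat_eqI_2) (simp_all add: adjoint_index_carrier[of _ 2 2])
  have "0 \<le> Re ((?M *\<^sub>v v) \<bullet>c v)" if v: "v \<in> carrier_vec 2" for v
  proof -
    define x y where "x = v $ 0" and "y = v $ 1"
    define f where "f = a * (cmod x)\<^sup>2 + d * (cmod y)\<^sup>2 + 2 * Re (b * y * cnj x)"
    have "Re ((?M *\<^sub>v v) \<bullet>c v) = f"
      using v by (simp add: scalar_prod_def sum_upto_2 conjugate_complex_def row_def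
        f_def x_def y_def cmod_power2) (simp add: algebra_simps power2_eq_square)
    moreover have "0 \<le> f"
    proof (cases "a = 0")
      case True
      then have "b = 0" using assms(3) by simp
      with True show ?thesis using assms by (simp add: f_def)
    next
      case False
      \<comment> \<open>Completing the square, after multiplication by \<open>a\<close> to avoid a
        division.\<close>
      have "a * f = (cmod (of_real a * x + b * y))\<^sup>2 + (a * d - (cmod b)\<^sup>2) * (cmod y)\<^sup>2"
        by (simp add: f_def cmod_power2) (simp add: algebra_simps power2_eq_square)
      also have "\<dots> \<ge> 0" using assms(3) by simp
      finally show ?thesis using False assms(1) by (simp add: zero_le_mult_iff)
    qed
    ultimately show ?thesis by simp
  qed
  with h show ?thesis by (simp add: psd_def)
qed

lemma char_poly_2:
  fixes A :: "complex mat"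
  assumes "A \<in> carrier_mat 2 2"
  shows "char_poly A = [: Determinant.det A, - (A $$ (0,0) + A $$ (1,1)), 1 :]"
proof -
  have "char_poly_matrix A \<in> carrier_mat 2 2" using assms by simp
  then have "char_poly A = char_poly_matrix A $$ (0,0) * char_poly_matrix A $$ (1,1)
      - char_poly_matrix A $$ (0,1) * char_poly_matrix A $$ (1,0)"
    unfolding char_poly_def by (rule det_2)
  then show ?thesis
    using assms by (simp add: char_poly_matrix_def det_2)
qed

text \<open>The quadratic formula gives the eigenvalues of the Gram matrix of the columns of
  \<open>A\<close>. The last conclusion is its characteristic equation at the larger eigenvalue, in
  the form that \<open>psd_2I\<close> needs.\<close>

lemma largest_singular_value_2:
  fixes A :: "complex mat"
  assumes A: "A \<in> carrier_mat 2 2" and d: "Determinant.det A \<noteq> 0"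
  defines "p \<equiv> (cmod (A $$ (0,0)))\<^sup>2 + (cmod (A $$ (1,0)))\<^sup>2"
    and "r \<equiv> (cmod (A $$ (0,1)))\<^sup>2 + (cmod (A $$ (1,1)))\<^sup>2"
    and "q \<equiv> cnj (A $$ (0,0)) * A $$ (0,1) + cnj (A $$ (1,0)) * A $$ (1,1)"
  defines "l1 \<equiv> (singular_values A ! 0)\<^sup>2"
  shows "0 < singular_values A ! 0" "p \<le> l1" "r \<le> l1" "(l1 - p) * (l1 - r) = (cmod q)\<^sup>2"
proof -
  define w where "w = sqrt ((p - r)\<^sup>2 + 4 * (cmod q)\<^sup>2)"
  define l m where "l = (p + r + w) / 2" and "m = (p + r - w) / 2"
  have w2: "w\<^sup>2 = (p - r)\<^sup>2 + 4 * (cmod q)\<^sup>2" by (simp add: w_def)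
  have w: "\<bar>p - r\<bar> \<le> w" unfolding w_def by (intro real_le_rsqrt) simp
  have w0: "0 \<le> w" using w by linarith
  have dt: "p * r - (cmod q)\<^sup>2 = (cmod (Determinant.det A))\<^sup>2"
    using gram_2(2)[OF A] unfolding p_def q_def r_def .
  have lm: "l * m = p * r - (cmod q)\<^sup>2"
    using w2 by (simp add: l_def m_def field_simps power2_eq_square)
  have pr: "0 \<le> p" "0 \<le> r" by (simp_all add: p_def r_def)
  have lm0: "0 < l * m" unfolding lm dt using d by simp
  then have l0: "0 < l" using pr w0 by (cases "l = 0") (auto simp: l_def)
  have m0: "0 < m" using lm0 l0 by (simp add: zero_less_mult_iff)
  have ml: "m \<le> l" using w0 by (simp add: l_def m_def)
  have G: "mat_adjoint A * A = mat_2 (complex_of_real p) q (cnj q) (complex_of_real r)"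
    using gram_2(1)[OF A] unfolding p_def q_def r_def .
  have "char_poly (mat_adjoint A * A) = [: complex_of_real (p * r - (cmod q)\<^sup>2), - complex_of_real (p + r), 1 :]"
    unfolding G by (subst char_poly_2)
      (auto simp: det_2 complex_norm_square simp del: of_real_power)
  also have "\<dots> = [: - complex_of_real l, 1 :] * [: - complex_of_real m, 1 :]"
    unfolding lm[symmetric] by (simp add: l_def m_def field_simps)
  finally have "proots (char_poly (mat_adjoint A * A)) = {# complex_of_real l, complex_of_real m #}"
    by (simp add: proots_mult del: mult_pCons_left mult_pCons_right)
  then have "singular_values A = rev (sorted_list_of_multiset {# sqrt l, sqrt m #})"
    by (simp add: singular_values_def)
  also have "sorted_list_of_multiset {# sqrt l, sqrt m #} = [sqrt m, sqrt l]"
    using ml by simp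
  finally have sv: "singular_values A ! 0 = sqrt l" by simp
  then have l1l: "l1 = l" using l0 by (simp add: l1_def)
  show "0 < singular_values A ! 0" using sv l0 by simp
  show "p \<le> l1" "r \<le> l1" unfolding l1l l_def using w by (auto simp: abs_le_iff)
  have "(l - p) * (l - r) = (w\<^sup>2 - (p - r)\<^sup>2) / 4"
    by (simp add: l_def field_simps power2_eq_square)
  then show "(l1 - p) * (l1 - r) = (cmod q)\<^sup>2" by (simp add: l1l w2)
qed

text \<open>After division by the largest singular value, the matrix 1 minus the Gram matrix has
  nonnegative diagonal and determinant zero, so \<open>psd_2I\<close> applies in its boundary
  case.\<close>

lemma filter_op_normalize:
  assumes A: "A \<in> carrier_mat 2 2" and d: "Determinant.det A \<noteq> 0"
  shows "filter_op (normalize_op A)"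
proof -
  define p r q l where "p = (cmod (A $$ (0,0)))\<^sup>2 + (cmod (A $$ (1,0)))\<^sup>2"
    and "r = (cmod (A $$ (0,1)))\<^sup>2 + (cmod (A $$ (1,1)))\<^sup>2"
    and "q = cnj (A $$ (0,0)) * A $$ (0,1) + cnj (A $$ (1,0)) * A $$ (1,1)"
    and "l = (singular_values A ! 0)\<^sup>2"
  note * = largest_singular_value_2[OF A d, folded p_def r_def q_def l_def]
  have l: "0 < l" using *(1) by (simp add: l_def)
  have G: "mat_adjoint A * A = mat_2 (complex_of_real p) q (cnj q) (complex_of_real r)"
    using gram_2(1)[OF A] unfolding p_def q_def r_def .
  have "mat_adjoint (normalize_op A) * normalize_op A = complex_of_real (1 / l) \<cdot>\<^sub>m (mat_adjoint A * A)"
    using A by (simp add: normalize_op_def adjoint_smult mult_smult_assoc_mat[of _ 2 2 _ 2]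
      mult_smult_distrib[of _ 2 2 _ 2] smult_smult_mat l_def power2_eq_square)
  then have "1\<^sub>m 2 - mat_adjoint (normalize_op A) * normalize_op A
      = mat_2 (complex_of_real (1 - p / l)) (- q / l) (cnj (- q / l)) (complex_of_real (1 - r / l))"
    by (intro mat_eqI_2) (simp_all add: G minus_carrier_mat)
  moreover have "(cmod (- q / l))\<^sup>2 \<le> (1 - p / l) * (1 - r / l)"
    using l by (simp add: norm_divide power_divide flip: *(4)) (simp add: field_simps power2_eq_square)
  ultimately have "psd 2 (1\<^sub>m 2 - mat_adjoint (normalize_op A) * normalize_op A)"
    using * l by (simp only:) (rule psd_2I, auto)
  then show ?thesis
    using A d *(1) by (auto simp: filter_op_def normalize_op_def)
qed

section \<open>Concurrence from a factorization\<close>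

text \<open>With X the indeterminate times the identity, both sides are determinants of block
  matrices, with rows (X, A), (B, 1) and (1, B), (A, X). These differ by a swap of the block rows
  and of the block columns. The block determinant formula needs only that the lower two blocks
  commute, so no inverse is taken over the polynomial ring.\<close>

lemma char_poly_mult_commute:
  fixes A B :: "'a :: idom mat"
  assumes A: "A \<in> carrier_mat n n" and B: "B \<in> carrier_mat n n"
  shows "char_poly (A * B) = char_poly (B * A)"
proof -
  define X A' B' where "X = [:0, 1:] \<cdot>\<^sub>m (1\<^sub>m n :: 'a poly mat)"
    and "A' = map_mat (\<lambda>a. [:a:]) A" and "B' = map_mat (\<lambda>a. [:a:]) B"
  have c: "X \<in> carrier_mat n n" "A' \<in> carrier_mat n n" "B' \<in> carrier_mat n n"
    using A B by (auto simp: X_def A'_def B'_def)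
  have const_sum: "[:sum f S:] = (\<Sum>k\<in>S. [:f k:])" for f :: "nat \<Rightarrow> 'a" and S
  proof (induction S rule: infinite_finite_induct)
    case (insert x F)
    then show ?case by (simp flip: insert.IH)
  qed auto
  have cp: "char_poly (C * D) = Determinant.det (X - map_mat (\<lambda>a. [:a:]) C * map_mat (\<lambda>a. [:a:]) D)"
    if "C \<in> carrier_mat n n" "D \<in> carrier_mat n n" for C D
  proof -
    have "char_poly_matrix (C * D) = X - map_mat (\<lambda>a. [:a:]) C * map_mat (\<lambda>a. [:a:]) D"
      using that
      by (intro eq_matI) (auto simp: char_poly_matrix_def X_def scalar_prod_def
        index_mult_mat(1) mult.commute simp flip: const_sum)
    then show ?thesis by (simp add: char_poly_def)
  qed
  define M where "M = four_block_mat X A' B' (1\<^sub>m n)"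
  define M' where "M' = four_block_mat (1\<^sub>m n) B' A' X"
  have M: "M \<in> carrier_mat (n + n) (n + n)" and M': "M' \<in> carrier_mat (n + n) (n + n)"
    using c by (auto simp: M_def M'_def)
  \<comment> \<open>\<open>N\<close> is \<open>M\<close> with its block rows exchanged; exchanging
    the block columns of \<open>N\<close> gives \<open>M'\<close>. The two swaps have the same sign,
    so the signs cancel.\<close>
  define N where "N = Matrix.mat (n + n) (n + n) (\<lambda>(i, j). M $$ (if i < n then i + n else i - n, j))"
  have N: "N \<in> carrier_mat (n + n) (n + n)" by (simp add: N_def)
  have "M' = Matrix.mat (n + n) (n + n) (\<lambda>(i, j). N $$ (i, if j < n then j + n else j - n))"
    using c by (intro eq_matI) (auto simp: M_def M'_def N_def)
  then have "Determinant.det M = (-1) ^ (n * n) * ((-1) ^ (n * n) * Determinant.det M')"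
    using det_swap_rows[OF M] det_swap_cols[OF N] by (simp add: N_def)
  then have MM': "Determinant.det M = Determinant.det M'"
    by (simp add: mult.assoc[symmetric] power_mult_distrib[symmetric])
  have "Determinant.det M = Determinant.det (X * 1\<^sub>m n - A' * B')"
    unfolding M_def using c by (intro det_four_block_mat) auto
  moreover have "Determinant.det M' = Determinant.det (1\<^sub>m n * X - B' * A')"
  proof -
    have "A' * X = X * A'"
      unfolding X_def using c
      by (simp add: mult_smult_distrib[of _ n n _ n] mult_smult_assoc_mat[of _ n n _ n])
    then show ?thesis unfolding M'_def using c by (intro det_four_block_mat) auto
  qed
  ultimately show ?thesis
    using MM' c cp[OF A B] cp[OF B A] by (simp add: A'_def B'_def)
qed

lemma proots_linear_factors: "proots (\<Prod>a\<leftarrow>as. [:- a, 1:]) = mset (as :: 'a :: idom list)"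
proof (induction as)
  case (Cons a as)
  have "(\<Prod>a\<leftarrow>as. [:- a, 1:]) \<noteq> 0" by (auto simp: prod_list_zero_iff)
  then show ?case using Cons by (simp add: proots_mult del: mult_pCons_left)
qed simp

text \<open>Schur triangularization reduces the claim to the diagonal of a triangular matrix, where
  scaling is visible; \<open>c = 0\<close> is covered as well.\<close>

lemma proots_char_poly_smult:
  fixes N :: "complex mat"
  assumes N: "N \<in> carrier_mat n n"
  shows "proots (char_poly (c \<cdot>\<^sub>m N)) = image_mset ((*) c) (proots (char_poly N))"
proof -
  obtain as where as: "char_poly N = (\<Prod>a\<leftarrow>as. [:- a, 1:])" using char_poly_factorized[OF N] by blast
  obtain U where U: "U \<in> carrier_mat n n" "upper_triangular U" "similar_mat N U"
    using schur_decomposition_exists[OF N as] by blast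
  have "char_poly (c \<cdot>\<^sub>m N) = char_poly (c \<cdot>\<^sub>m U)"
    by (intro char_poly_similar similar_mat_smult U)
  also have "\<dots> = (\<Prod>a\<leftarrow>diag_mat (c \<cdot>\<^sub>m U). [:- a, 1:])"
    using U by (intro char_poly_upper_triangular[of _ n]) (auto simp: upper_triangular_def)
  finally have "proots (char_poly (c \<cdot>\<^sub>m N)) = mset (diag_mat (c \<cdot>\<^sub>m U))"
    by (simp only: proots_linear_factors)
  also have "diag_mat (c \<cdot>\<^sub>m U) = map ((*) c) (diag_mat U)" using U by (simp add: diag_mat_def)
  also have "mset \<dots> = image_mset ((*) c) (proots (\<Prod>a\<leftarrow>diag_mat U. [:- a, 1:]))"
    by (simp only: proots_linear_factors mset_map)
  also have "(\<Prod>a\<leftarrow>diag_mat U. [:- a, 1:]) = char_poly N"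
    using char_poly_upper_triangular[OF U(1,2)] char_poly_similar[OF U(3)] by simp
  finally show ?thesis .
qed

lemma sorted_list_of_multiset_image_mono:
  assumes "mono f"
  shows "sorted_list_of_multiset (image_mset f M) = map f (sorted_list_of_multiset M)"
proof -
  have "sorted (map f (sorted_list_of_multiset M))"
    using assms by (simp add: sorted_map sorted_wrt_mono_rel[OF _ sorted_sorted_list_of_multiset] monoD)
  then have "sorted_list_of_multiset (mset (map f (sorted_list_of_multiset M)))
      = map f (sorted_list_of_multiset M)"
    by (simp only: sorted_list_of_multiset_mset sorted_sort_id)
  then show ?thesis by (simp add: mset_map)
qed

lemma singular_values_smult:
  assumes M: "M \<in> carrier_mat n n"
  shows "singular_values (c \<cdot>\<^sub>m M) = map ((*) (cmod c)) (singular_values M)"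
proof -
  have G: "mat_adjoint M * M \<in> carrier_mat n n" using M by auto
  have "mat_adjoint (c \<cdot>\<^sub>m M) * (c \<cdot>\<^sub>m M) = complex_of_real ((cmod c)\<^sup>2) \<cdot>\<^sub>m (mat_adjoint M * M)"
    using M by (simp add: adjoint_smult mult_smult_assoc_mat[of _ n n _ n]
      mult_smult_distrib[of _ n n _ n] smult_smult_mat complex_norm_square mult.commute del: of_real_power)
  then have p: "proots (char_poly (mat_adjoint (c \<cdot>\<^sub>m M) * (c \<cdot>\<^sub>m M)))
      = image_mset ((*) (complex_of_real ((cmod c)\<^sup>2))) (proots (char_poly (mat_adjoint M * M)))"
    using proots_char_poly_smult[OF G] by simp
  have "sqrt (Re (complex_of_real ((cmod c)\<^sup>2) * z)) = cmod c * sqrt (Re z)" for z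
    by (simp add: real_sqrt_mult)
  then have "image_mset (\<lambda>z. sqrt (Re z)) (proots (char_poly (mat_adjoint (c \<cdot>\<^sub>m M) * (c \<cdot>\<^sub>m M))))
     = image_mset ((*) (cmod c)) (image_mset (\<lambda>z. sqrt (Re z)) (proots (char_poly (mat_adjoint M * M))))"
    unfolding p by (simp add: image_mset.compositionality o_def del: Re_complex_of_real of_real_power)
  moreover have "mono ((*) (cmod c))" by (intro monoI mult_left_mono) auto
  ultimately show ?thesis
    unfolding singular_values_def
    by (simp add: sorted_list_of_multiset_image_mono rev_map del: image_mset.compositionality)
qed

text \<open>The concurrence formula detached from the choice of factor inside
  \<open>concurrence\<close>.\<close>

definition tau_gap :: "real list \<Rightarrow> real" where
  "tau_gap \<tau> = max 0 (\<tau> ! 0 - \<tau> ! 1 - \<tau> ! 2 - \<tau> ! 3)"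

lemma length_singular_values: "M \<in> carrier_mat n n \<Longrightarrow> length (singular_values M) = n"
proof -
  assume "M \<in> carrier_mat n n"
  then have "mat_adjoint M * M \<in> carrier_mat n n" by auto
  from char_poly_factorized[OF this] show ?thesis
    by (auto simp: singular_values_def proots_linear_factors size_mset[symmetric]
      simp del: size_mset)
qed

lemma tau_gap_smult:
  assumes "M \<in> carrier_mat 4 4"
  shows "tau_gap (singular_values (c \<cdot>\<^sub>m M)) = cmod c * tau_gap (singular_values M)"
proof -
  \<comment> \<open>The length makes all four indices valid, so that \<open>!\<close> commutes with
    \<open>map\<close>.\<close>
  have "length (singular_values M) = 4" using assms by (rule length_singular_values)
  then have "tau_gap (singular_values (c \<cdot>\<^sub>m M)) = max 0 (cmod c * (singular_values M ! 0
      - singular_values M ! 1 - singular_values M ! 2 - singular_values M ! 3))"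
    by (simp add: tau_gap_def singular_values_smult[OF assms] algebra_simps)
  then show ?thesis by (simp add: tau_gap_def max_mult_distrib_left)
qed

text \<open>By cyclicity of the characteristic polynomial, the singular values of
  \<open>X\<^sup>T (\<sigma>\<^sub>y \<otimes> \<sigma>\<^sub>y) X\<close> depend on \<open>X X\<^sup>\<dagger>\<close> only.\<close>

lemma concurrence_factor:
  assumes X: "X \<in> carrier_mat 4 4"
  shows "concurrence (X * mat_adjoint X)
    = tau_gap (singular_values (transpose_mat X * kron (pauli 2) (pauli 2) * X))"
proof -
  define S where "S = kron (pauli 2) (pauli 2)"
  have S: "S \<in> carrier_mat 4 4" "mat_adjoint S = S"
    unfolding S_def spin_flip_eq by (auto intro!: eq_matI simp: adjoint_index)
  \<comment> \<open>Moving the last factor \<open>Y\<close> to the front leaves an expression in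
    \<open>Y * mat_adjoint Y\<close> alone. It is Wootters' matrix \<rho> S cnj \<rho> S, since the
    transpose of a Hermitian matrix is its conjugate.\<close>
  have cp: "char_poly (mat_adjoint (transpose_mat Y * S * Y) * (transpose_mat Y * S * Y))
      = char_poly ((Y * mat_adjoint Y) * S * transpose_mat (Y * mat_adjoint Y) * S)"
    if Y: "Y \<in> carrier_mat 4 4" for Y
  proof -
    note [simp] = Y S
    have [simp]: "mat_adjoint Y \<in> carrier_mat 4 4" "map_mat cnj Y \<in> carrier_mat 4 4" using Y by auto
    have t: "mat_adjoint (transpose_mat Y) = map_mat cnj Y"
      by (rule eq_matI) (auto simp: adjoint_index)
    have "mat_adjoint (transpose_mat Y * S * Y) = mat_adjoint Y * S * map_mat cnj Y"
      by (simp add: adjoint_mult[of _ 4 4 _ 4] assoc_mult_4 t)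
    then have "mat_adjoint (transpose_mat Y * S * Y) * (transpose_mat Y * S * Y)
      = (mat_adjoint Y * S * map_mat cnj Y * transpose_mat Y * S) * Y"
      by (simp add: assoc_mult_4)
    also have "char_poly \<dots> = char_poly (Y * (mat_adjoint Y * S * map_mat cnj Y * transpose_mat Y * S))"
      by (rule char_poly_mult_commute[of _ 4]) auto
    also have "Y * (mat_adjoint Y * S * map_mat cnj Y * transpose_mat Y * S)
      = (Y * mat_adjoint Y) * S * transpose_mat (Y * mat_adjoint Y) * S"
      by (simp add: transpose_mult[of _ 4 4 _ 4] adjoint_eq_transpose assoc_mult_4)
    finally show ?thesis .
  qed
  define Y where "Y = (SOME Y. Y \<in> carrier_mat 4 4 \<and> X * mat_adjoint X = Y * mat_adjoint Y)"
  \<comment> \<open>\<open>X\<close> itself is a factor, so the choice returns a genuine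
    one.\<close>
  have "Y \<in> carrier_mat 4 4 \<and> X * mat_adjoint X = Y * mat_adjoint Y"
    unfolding Y_def by (rule someI[of _ X]) (use X in auto)
  then have "singular_values (transpose_mat Y * S * Y) = singular_values (transpose_mat X * S * X)"
    using cp[of X] cp[of Y] X by (simp add: singular_values_def)
  then show ?thesis
    by (simp add: concurrence_def tau_gap_def Let_def Y_def[symmetric] S_def[symmetric])
qed

section \<open>Rank under multiplication by invertible matrices\<close>

context vec_space
begin

lemma col_space_eq_image:
  assumes A: "A \<in> carrier_mat n nc"
  shows "col_space A = (\<lambda>x. A *\<^sub>v x) ` carrier_vec nc"
  using A by (auto simp: col_space_eq[OF A])

lemma col_space_mult_right:
  assumes A: "A \<in> carrier_mat n nc" and P: "P \<in> carrier_mat nc nc" "Q \<in> carrier_mat nc nc"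
    and PQ: "P * Q = 1\<^sub>m nc"
  shows "col_space (A * P) = col_space A"
proof -
  have AP: "A * P \<in> carrier_mat n nc" using A P by simp
  have 1: "A * P *\<^sub>v x = A *\<^sub>v (P *\<^sub>v x)" if "x \<in> carrier_vec nc" for x
    by (rule assoc_mult_mat_vec[OF A P(1) that])
  have 2: "A *\<^sub>v x = A * P *\<^sub>v (Q *\<^sub>v x)" if x: "x \<in> carrier_vec nc" for x
  proof -
    have Q: "Q *\<^sub>v x \<in> carrier_vec nc" by (rule mult_mat_vec_carrier[OF P(2) x])
    have "P *\<^sub>v (Q *\<^sub>v x) = x"
      using assoc_mult_mat_vec[OF P x] PQ x by simp
    then show ?thesis using 1[OF Q] by simp
  qed
  show ?thesis
    unfolding col_space_eq_image[OF A] col_space_eq_image[OF AP]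
  proof (intro equalityI image_subsetI)
    fix x :: "'a vec" assume x: "x \<in> carrier_vec nc"
    show "A * P *\<^sub>v x \<in> (\<lambda>x. A *\<^sub>v x) ` carrier_vec nc"
      unfolding 1[OF x] by (intro imageI mult_mat_vec_carrier[OF P(1) x])
  next
    fix x :: "'a vec" assume x: "x \<in> carrier_vec nc"
    show "A *\<^sub>v x \<in> (\<lambda>x. A * P *\<^sub>v x) ` carrier_vec nc"
      by (subst 2[OF x]) (intro imageI mult_mat_vec_carrier[OF P(2) x])
  qed
qed

text \<open>Left multiplication changes the column space, unlike right multiplication, but
  \<open>K\<close> maps the old space linearly and bijectively onto the new one, so the dimensions
  agree.\<close>

lemma rank_mult_left_invertible:
  assumes A: "A \<in> carrier_mat n nc" and K: "K \<in> carrier_mat n n" "J \<in> carrier_mat n n"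
    and JK: "J * K = 1\<^sub>m n"
  shows "rank (K * A) = rank A"
proof -
  have KA: "K * A \<in> carrier_mat n nc" using K A by simp
  have img: "(\<lambda>v. K *\<^sub>v v) ` col_space A = col_space (K * A)"
    unfolding col_space_eq_image[OF A] col_space_eq_image[OF KA] image_image
    by (intro image_cong refl assoc_mult_mat_vec[OF K(1) A, symmetric])
  have sub: "VectorSpace.subspace class_ring (col_space B) V" if "B \<in> carrier_mat n nc" for B
    unfolding col_space_def using that cols_dim[of B] by (intro span_is_subspace) auto
  have vs: "vectorspace class_ring (vs (col_space B))" if "B \<in> carrier_mat n nc" for B
    by (rule subspace_is_vs[OF sub[OF that]])
  have carr: "col_space A \<subseteq> carrier_vec n" using A by (auto simp: col_space_eq_image[OF A])
  have lin: "linear_map class_ring (vs (col_space A)) (vs (col_space (K * A))) (\<lambda>v. K *\<^sub>v v)"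
  proof -
    have "(\<lambda>v. K *\<^sub>v v) \<in> LinearCombinations.module_hom class_ring (vs (col_space A)) (vs (col_space (K * A)))"
      unfolding LinearCombinations.module_hom_def using img carr K
      by (auto simp: mult_add_distrib_mat_vec[OF K(1)] mult_mat_vec[OF K(1)] subset_iff)
    then show ?thesis
      using vs[OF A] vs[OF KA]
      by (auto simp: linear_map_def mod_hom_def mod_hom_axioms_def vectorspace_def)
  qed
  have "inj_on (\<lambda>v. K *\<^sub>v v) (col_space A)"
  proof (rule inj_on_inverseI[where g = "\<lambda>v. J *\<^sub>v v"])
    fix v assume "v \<in> col_space A"
    then have v: "v \<in> carrier_vec n" using carr by auto
    show "J *\<^sub>v (K *\<^sub>v v) = v" using assoc_mult_mat_vec[OF K(2,1) v] JK v by simp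
  qed
  moreover have "vectorspace.fin_dim class_ring (vs (col_space A))"
    unfolding col_space_def using A cols_dim[of A] by (intro fin_dim_span) auto
  ultimately have "vectorspace.dim class_ring (vs (col_space A)) = vectorspace.dim class_ring (vs (col_space (K * A)))"
    using img by (intro linear_map.dim_eq[OF lin]) auto
  then show ?thesis by (simp add: rank_def col_space_def)
qed

lemma rank_congruence_invertible:
  assumes A: "A \<in> carrier_mat n n" and K: "K \<in> carrier_mat n n" "J \<in> carrier_mat n n" "J * K = 1\<^sub>m n"
    and P: "P \<in> carrier_mat n n" "Q \<in> carrier_mat n n" "P * Q = 1\<^sub>m n"
  shows "rank (K * A * P) = rank A"
proof -
  have "rank (K * A * P) = rank (K * A)"
    using col_space_mult_right[OF _ P, of "K * A"] A K by (simp add: rank_def col_space_def)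
  also have "\<dots> = rank A" by (rule rank_mult_left_invertible[OF A K])
  finally show ?thesis .
qed

end

section \<open>Timelike vectors\<close>

text \<open>The row consists of the traces of \<open>pauli j\<close> times the Gram matrix of
  \<open>A\<close>, divided by 2 |det A|. Its Minkowski square is the determinant of the Gram matrix
  over |det A|^2, which is 1.\<close>

lemma lorentz_of_row_0:
  assumes A: "A \<in> carrier_mat 2 2" and d: "Determinant.det A \<noteq> 0"
  obtains x :: "nat \<Rightarrow> real" where "\<And>j. j < 4 \<Longrightarrow> lorentz_of A $$ (0, j) = complex_of_real (x j)"
    "0 < x 0" "(x 0)\<^sup>2 = 1 + (x 1)\<^sup>2 + (x 2)\<^sup>2 + (x 3)\<^sup>2"
proof -
  define p r q n where "p = (Re (A $$ (0,0)))\<^sup>2 + (Im (A $$ (0,0)))\<^sup>2 + (Re (A $$ (1,0)))\<^sup>2 + (Im (A $$ (1,0)))\<^sup>2"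
    and "r = (Re (A $$ (0,1)))\<^sup>2 + (Im (A $$ (0,1)))\<^sup>2 + (Re (A $$ (1,1)))\<^sup>2 + (Im (A $$ (1,1)))\<^sup>2"
    and "q = A $$ (0,0) * cnj (A $$ (0,1)) + A $$ (1,0) * cnj (A $$ (1,1))"
    and "n = cmod (Determinant.det A)"
  have n: "0 < n" using d by (simp add: n_def)
  have g: "p * r - (cmod q)\<^sup>2 = n\<^sup>2"
    unfolding det_2[OF A] p_def q_def r_def n_def cmod_power2
    by (simp add: power2_eq_square algebra_simps)
  define x :: "nat \<Rightarrow> real" where
    "x = (\<lambda>j. if j = 0 then (p + r) / (2 * n) else if j = 1 then Re q / n
      else if j = 2 then Im q / n else (p - r) / (2 * n))"
  have cA: "map_mat cnj A \<in> carrier_mat 2 2" using A by simp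
  have e: "(T_mat * kron A (map_mat cnj A) * mat_adjoint T_mat) $$ (0, j) = complex_of_real (n * x j)"
    if "j < 4" for j
    using that A cA n unfolding less_4_iff
    by (elim disjE)
      (simp_all add: T_simps kron_index x_def,
       simp_all add: algebra_simps rsqrt2_square,
       simp_all add: complex_eq_iff p_def r_def q_def power2_eq_square,
       simp_all add: field_simps)
  have "lorentz_of A $$ (0, j) = complex_of_real (x j)" if "j < 4" for j
    using e[OF that] that n A by (simp add: lorentz_of_def n_def[symmetric])
  moreover have "0 < x 0"
  proof -
    have "0 < p * r" using g n by (smt (verit) zero_less_power zero_le_power2)
    moreover have "0 \<le> p" "0 \<le> r" by (simp_all add: p_def r_def)
    ultimately have "0 < p" "0 < r" by (auto simp: zero_less_mult_iff)
    then show ?thesis using n by (simp add: x_def)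
  qed
  moreover have "(x 0)\<^sup>2 = 1 + (x 1)\<^sup>2 + (x 2)\<^sup>2 + (x 3)\<^sup>2"
  proof -
    have "(p + r)\<^sup>2 = 4 * n\<^sup>2 + 4 * (Re q)\<^sup>2 + 4 * (Im q)\<^sup>2 + (p - r)\<^sup>2"
      using g by (simp add: cmod_power2) (simp add: power2_eq_square algebra_simps)
    then have "(x 0)\<^sup>2 = (4 * n\<^sup>2 + 4 * (Re q)\<^sup>2 + 4 * (Im q)\<^sup>2 + (p - r)\<^sup>2) / (4 * n\<^sup>2)"
      by (simp add: x_def power_divide power_mult_distrib)
    also have "\<dots> = 1 + (x 1)\<^sup>2 + (x 2)\<^sup>2 + (x 3)\<^sup>2"
      using n by (simp add: x_def power_divide power_mult_distrib add_divide_distrib)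
    finally show ?thesis .
  qed
  ultimately show ?thesis using that by blast
qed

text \<open>In the worst case the spatial terms sum to - s_0 c, with c the sum of the |x_i y_i|, so
  x_0 y_0 \<ge> 1 + c is enough. For squared spatial lengths P and Q, Cauchy-Schwarz gives c^2 \<le>
  P Q and the mean inequality 2 c \<le> P + Q; together (1 + c)^2 \<le> (1 + P) (1 + Q).\<close>

lemma timelike_weighted_product:
  fixes x y s :: "nat \<Rightarrow> real"
  assumes x: "0 < x 0" "(x 0)\<^sup>2 = 1 + (x 1)\<^sup>2 + (x 2)\<^sup>2 + (x 3)\<^sup>2"
    and y: "0 < y 0" "(y 0)\<^sup>2 = 1 + (y 1)\<^sup>2 + (y 2)\<^sup>2 + (y 3)\<^sup>2"
    and s: "\<bar>s 1\<bar> \<le> s 0" "\<bar>s 2\<bar> \<le> s 0" "\<bar>s 3\<bar> \<le> s 0"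
  shows "s 0 \<le> s 0 * x 0 * y 0 + s 1 * x 1 * y 1 + s 2 * x 2 * y 2 + s 3 * x 3 * y 3"
proof -
  define c where "c = \<bar>x 1 * y 1\<bar> + \<bar>x 2 * y 2\<bar> + \<bar>x 3 * y 3\<bar>"
  have c0: "0 \<le> c" by (simp add: c_def)
  \<comment> \<open>Cauchy-Schwarz from Lagrange's identity.\<close>
  have cs: "(a1 * b1 + a2 * b2 + a3 * b3)\<^sup>2 \<le> (a1\<^sup>2 + a2\<^sup>2 + a3\<^sup>2) * (b1\<^sup>2 + b2\<^sup>2 + b3\<^sup>2)"
    for a1 a2 a3 b1 b2 b3 :: real
  proof -
    have "(a1\<^sup>2 + a2\<^sup>2 + a3\<^sup>2) * (b1\<^sup>2 + b2\<^sup>2 + b3\<^sup>2) - (a1 * b1 + a2 * b2 + a3 * b3)\<^sup>2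
      = (a1 * b2 - a2 * b1)\<^sup>2 + (a1 * b3 - a3 * b1)\<^sup>2 + (a2 * b3 - a3 * b2)\<^sup>2"
      by (simp add: power2_eq_square algebra_simps)
    then show ?thesis by (smt (verit) zero_le_power2)
  qed
  define P Q where "P = (x 1)\<^sup>2 + (x 2)\<^sup>2 + (x 3)\<^sup>2" and "Q = (y 1)\<^sup>2 + (y 2)\<^sup>2 + (y 3)\<^sup>2"
  have c2: "c\<^sup>2 \<le> P * Q" 
    using cs[of "\<bar>x 1\<bar>" "\<bar>y 1\<bar>" "\<bar>x 2\<bar>" "\<bar>y 2\<bar>" "\<bar>x 3\<bar>" "\<bar>y 3\<bar>"]
    by (simp add: c_def P_def Q_def abs_mult)
  have PQ: "0 \<le> P" "0 \<le> Q" by (simp_all add: P_def Q_def)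
  have "(P + Q)\<^sup>2 = (P - Q)\<^sup>2 + 4 * (P * Q)" by (simp add: power2_eq_square algebra_simps)
  then have "4 * (P * Q) \<le> (P + Q)\<^sup>2" by simp
  with mult_left_mono[OF c2, of 4] have "4 * c\<^sup>2 \<le> (P + Q)\<^sup>2" by (meson order_trans zero_le_numeral)
  then have "(2 * c)\<^sup>2 \<le> (P + Q)\<^sup>2" by (simp add: power_mult_distrib)
  then have "2 * c \<le> P + Q" by (rule power2_le_imp_le) (simp add: PQ)
  then have "(1 + c)\<^sup>2 \<le> (1 + P) * (1 + Q)"
    using c2 by (simp add: power2_sum distrib_left distrib_right)
  also have "\<dots> = (x 0 * y 0)\<^sup>2"
    using x y by (simp add: P_def Q_def power_mult_distrib add.assoc)
  finally have "1 + c \<le> x 0 * y 0" by (rule power2_le_imp_le) (use x y in simp)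
  then have "s 0 * (1 + c) \<le> s 0 * (x 0 * y 0)" using s by (intro mult_left_mono) auto
  moreover have "- (s 0 * \<bar>x i * y i\<bar>) \<le> s i * x i * y i" if "\<bar>s i\<bar> \<le> s 0" for i
  proof -
    have "\<bar>s i * x i * y i\<bar> \<le> s 0 * \<bar>x i * y i\<bar>"
      using that by (simp add: abs_mult mult.assoc mult_right_mono)
    then show ?thesis by linarith
  qed
  from this[OF s(1)] this[OF s(2)] this[OF s(3)]
  have "- (s 0 * c) \<le> s 1 * x 1 * y 1 + s 2 * x 2 * y 2 + s 3 * x 3 * y 3"
    by (simp add: c_def algebra_simps)
  ultimately show ?thesis by (simp add: algebra_simps)
qed

section \<open>Lorentz matrices and their action on timelike vectors\<close>

lemma minkowski_carrier [simp]: "minkowski \<in> carrier_mat 4 4"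
  by (simp add: minkowski_def)

lemma minkowski_square: "minkowski * minkowski = 1\<^sub>m 4"
  unfolding minkowski_def mat_diag_diag by (rule eq_matI) (auto simp: mat_diag_def)

lemma minkowski_index: "i < 4 \<Longrightarrow> j < 4 \<Longrightarrow>
  minkowski $$ (i, j) = (if i = j then if i = 0 then 1 else - 1 else 0)"
  by (simp add: minkowski_def mat_diag_def)

text \<open>Since M squares to the identity, the defining relation says that \<open>K\<close> is a
  right inverse of \<open>L\<close>. For square matrices it is then a left inverse, which yields the
  relation for the columns of \<open>L\<close>.\<close>

lemma proper_orthochronous_inverse:
  assumes "proper_orthochronous L"
  defines "K \<equiv> minkowski * transpose_mat L * minkowski"
  shows "L * K = 1\<^sub>m 4" "K * L = 1\<^sub>m 4" "transpose_mat L * minkowski * L = minkowski"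
    "proper_orthochronous K"
proof -
  from assms have [simp]: "L \<in> carrier_mat 4 4" and l: "L * minkowski * transpose_mat L = minkowski"
    and det: "Determinant.det L = 1" and pos: "0 < L $$ (0,0)"
    by (auto simp: proper_orthochronous_def)
  have K [simp]: "K \<in> carrier_mat 4 4" by (simp add: K_def)
  have "L * K = (L * minkowski * transpose_mat L) * minkowski"
    by (simp add: K_def assoc_mult_4)
  then show 1: "L * K = 1\<^sub>m 4" unfolding l by (simp add: minkowski_square)
  then show 2: "K * L = 1\<^sub>m 4" by (rule mat_mult_left_right_inverse[rotated 2]) auto
  have "transpose_mat L * minkowski * L = (minkowski * minkowski) * (transpose_mat L * minkowski * L)"
    by (simp add: minkowski_square one_mult_4)
  also have "\<dots> = minkowski * (K * L)" by (simp add: K_def assoc_mult_4)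
  finally show 3: "transpose_mat L * minkowski * L = minkowski" by (simp add: 2 one_mult_4)
  have Mt: "transpose_mat minkowski = minkowski"
    by (rule eq_matI) (auto simp: minkowski_def mat_diag_def)
  have "transpose_mat K = minkowski * L * minkowski"
    by (simp add: K_def transpose_mult[of _ 4 4 _ 4] Mt assoc_mult_4)
  then have "K * minkowski * transpose_mat K
      = minkowski * transpose_mat L * (minkowski * minkowski) * (minkowski * L * minkowski)"
    by (simp add: K_def assoc_mult_4)
  also have "\<dots> = minkowski * (transpose_mat L * minkowski * L) * minkowski"
    by (simp add: minkowski_square one_mult_4 assoc_mult_4)
  also have "\<dots> = minkowski" by (simp add: 3 minkowski_square one_mult_4)
  finally have "K * minkowski * transpose_mat K = minkowski" .
  moreover have "Determinant.det K = 1"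
    using det_mult[of L 4 K] 1 det by simp
  moreover have "K $$ (0, 0) = L $$ (0, 0)"
    by (simp add: K_def mult_index_4[of _ 4 _ 4] minkowski_index transpose_index[of _ 4 4])
  ultimately show "proper_orthochronous K" using pos by (simp add: proper_orthochronous_def)
qed

lemma timelike_row_mult:
  fixes x :: "nat \<Rightarrow> real"
  assumes L: "proper_orthochronous L"
    and x: "0 < x 0" "(x 0)\<^sup>2 = 1 + (x 1)\<^sup>2 + (x 2)\<^sup>2 + (x 3)\<^sup>2"
  defines "u \<equiv> (\<lambda>j. x 0 * L $$ (0,j) + x 1 * L $$ (1,j) + x 2 * L $$ (2,j) + x 3 * L $$ (3,j) :: real)"
  shows "0 < u 0" "(u 0)\<^sup>2 = 1 + (u 1)\<^sup>2 + (u 2)\<^sup>2 + (u 3)\<^sup>2"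
proof -
  from L have c: "L \<in> carrier_mat 4 4" and l: "L * minkowski * transpose_mat L = minkowski"
    and pos: "0 < L $$ (0,0)"
    by (auto simp: proper_orthochronous_def)
  have r: "(L * minkowski * transpose_mat L) $$ (i, j) = minkowski $$ (i, j)" for i j by (simp add: l)
  have row: "L $$ (i,0) * L $$ (j,0) - L $$ (i,1) * L $$ (j,1) - L $$ (i,2) * L $$ (j,2) - L $$ (i,3) * L $$ (j,3)
      = (if i = j then if i = 0 then 1 else - 1 else 0)" if "i < 4" "j < 4" for i j
    using r[of i j] that c
    by (simp add: mult_index_4[of _ 4 _ 4] minkowski_index transpose_index[of _ 4 4])
  have "(transpose_mat L * minkowski * L) $$ (0, 0) = minkowski $$ (0, 0)"
    using proper_orthochronous_inverse(3)[OF L] by simp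
  then have col: "(L $$ (0,0))\<^sup>2 = 1 + (L $$ (1,0))\<^sup>2 + (L $$ (2,0))\<^sup>2 + (L $$ (3,0))\<^sup>2"
    using c by (simp add: mult_index_4[of _ 4 _ 4] minkowski_index transpose_index[of _ 4 4] power2_eq_square)
  \<comment> \<open>With all weights equal to 1 the weighted inequality applies to \<open>x\<close>
    and column 0 of \<open>L\<close>, which is also unit, timelike and future directed.\<close>
  have "1 \<le> u 0"
    using timelike_weighted_product[of x "\<lambda>i. L $$ (i,0)" "\<lambda>_. 1", OF x pos col] by (simp add: u_def)
  then show "0 < u 0" by simp
  have "(u 0)\<^sup>2 - (u 1)\<^sup>2 - (u 2)\<^sup>2 - (u 3)\<^sup>2 =
    (\<Sum>i\<in>{0..<4}. \<Sum>j\<in>{0..<4}. x i * x j * (L $$ (i,0) * L $$ (j,0) - L $$ (i,1) * L $$ (j,1)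
       - L $$ (i,2) * L $$ (j,2) - L $$ (i,3) * L $$ (j,3)))"
    by (simp add: u_def sum_upto_4 power2_eq_square) (simp add: algebra_simps)
  also have "\<dots> = (\<Sum>i\<in>{0..<4}. \<Sum>j\<in>{0..<4}. x i * x j * (if i = j then if i = 0 then 1 else - 1 else 0))"
    by (intro sum.cong refl) (subst row, auto)
  also have "\<dots> = 1" using x by (simp add: sum_upto_4 power2_eq_square)
  finally show "(u 0)\<^sup>2 = 1 + (u 1)\<^sup>2 + (u 2)\<^sup>2 + (u 3)\<^sup>2" by simp
qed

lemma lorentz_corner_bound:
  assumes A: "A \<in> carrier_mat 2 2" "Determinant.det A \<noteq> 0"
    and B: "B \<in> carrier_mat 2 2" "Determinant.det B \<noteq> 0"
    and L1: "proper_orthochronous L1" and L2: "proper_orthochronous L2"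
    and s: "\<bar>s 1\<bar> \<le> s 0" "\<bar>s 2\<bar> \<le> s 0" "\<bar>s 3\<bar> \<le> s 0"
  obtains t where "s 0 \<le> t"
    "(lorentz_of A * map_mat complex_of_real (L1 * mat_diag 4 s * transpose_mat L2)
       * transpose_mat (lorentz_of B)) $$ (0, 0) = complex_of_real t"
proof -
  obtain x where x: "\<And>j. j < 4 \<Longrightarrow> lorentz_of A $$ (0, j) = complex_of_real (x j)"
      and x': "0 < x 0" "(x 0)\<^sup>2 = 1 + (x 1)\<^sup>2 + (x 2)\<^sup>2 + (x 3)\<^sup>2"
    using lorentz_of_row_0[OF A] by blast
  obtain y where y: "\<And>j. j < 4 \<Longrightarrow> lorentz_of B $$ (0, j) = complex_of_real (y j)"
      and y': "0 < y 0" "(y 0)\<^sup>2 = 1 + (y 1)\<^sup>2 + (y 2)\<^sup>2 + (y 3)\<^sup>2"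
    using lorentz_of_row_0[OF B] by blast
  define u v where "u = (\<lambda>j. x 0 * L1 $$ (0,j) + x 1 * L1 $$ (1,j) + x 2 * L1 $$ (2,j) + x 3 * L1 $$ (3,j))"
    and "v = (\<lambda>j. y 0 * L2 $$ (0,j) + y 1 * L2 $$ (1,j) + y 2 * L2 $$ (2,j) + y 3 * L2 $$ (3,j))"
  have u: "0 < u 0" "(u 0)\<^sup>2 = 1 + (u 1)\<^sup>2 + (u 2)\<^sup>2 + (u 3)\<^sup>2"
    using timelike_row_mult[OF L1 x'] by (simp_all add: u_def)
  have v: "0 < v 0" "(v 0)\<^sup>2 = 1 + (v 1)\<^sup>2 + (v 2)\<^sup>2 + (v 3)\<^sup>2"
    using timelike_row_mult[OF L2 y'] by (simp_all add: v_def)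
  have c: "L1 \<in> carrier_mat 4 4" "L2 \<in> carrier_mat 4 4"
    using L1 L2 by (auto simp: proper_orthochronous_def)
  define R where "R = L1 * mat_diag 4 s * transpose_mat L2"
  have R: "R \<in> carrier_mat 4 4" using c by (simp add: R_def)
  have Rij: "R $$ (i, j) = (\<Sum>k\<in>{0..<4}. L1 $$ (i,k) * s k * L2 $$ (j,k))" if "i < 4" "j < 4" for i j
    using that c by (simp add: R_def mat_diag_mult_right[OF c(1)] mult_index_4[of _ 4 _ 4] sum_upto_4
      transpose_index[of _ 4 4])
  have "(lorentz_of A * map_mat complex_of_real R * transpose_mat (lorentz_of B)) $$ (0, 0)
     = (\<Sum>j\<in>{0..<4}. (\<Sum>i\<in>{0..<4}. complex_of_real (x i) * complex_of_real (R $$ (i,j))) * complex_of_real (y j))"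
    using R by (simp add: mult_index_4[of _ 4 _ 4] sum_upto_4 transpose_index[of _ 4 4] x y)
  also have "\<dots> = complex_of_real (\<Sum>j\<in>{0..<4}. (\<Sum>i\<in>{0..<4}. x i * R $$ (i,j)) * y j)"
    by simp
  also have "(\<Sum>j\<in>{0..<4}. (\<Sum>i\<in>{0..<4}. x i * R $$ (i,j)) * y j) = (\<Sum>k\<in>{0..<4}. s k * u k * v k)"
    by (simp add: Rij sum_upto_4 u_def v_def) (simp add: algebra_simps)
  also have "\<dots> = s 0 * u 0 * v 0 + s 1 * u 1 * v 1 + s 2 * u 2 * v 2 + s 3 * u 3 * v 3"
    by (simp add: sum_upto_4)
  finally show ?thesis
    using timelike_weighted_product[OF u v s] that by (simp only: R_def)
qed

section \<open>Spinors of Lorentz transformations\<close>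

text \<open>The Hermitian matrix with Pauli coordinates n has determinant n0^2 - n1^2 - n2^2 - n3^2
  = 0 and nonnegative trace, so it is a column (u, v) times its adjoint.\<close>

lemma null_vector_spinor:
  fixes n0 n1 n2 n3 :: real
  assumes null: "n0\<^sup>2 = n1\<^sup>2 + n2\<^sup>2 + n3\<^sup>2" and "0 \<le> n0"
  obtains u v :: complex where "complex_of_real (n0 + n3) = u * cnj u"
    "complex_of_real (n0 - n3) = v * cnj v" "Complex n1 (- n2) = u * cnj v"
proof -
  have "n3\<^sup>2 \<le> n0\<^sup>2" using null by simp
  then have le: "\<bar>n3\<bar> \<le> n0" using assms(2) abs_le_square_iff[of n3 n0] by simp
  have m: "(n0 + n3) * (n0 - n3) = n1\<^sup>2 + n2\<^sup>2" using null by (simp add: algebra_simps power2_eq_square)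
  show ?thesis
  proof (cases "n0 + n3 = 0")
    case True
    then have "n1 = 0" "n2 = 0" using m by (simp_all add: sum_power2_eq_zero_iff)
    with True le show ?thesis
      by (intro that[of 0 "complex_of_real (sqrt (n0 - n3))"]) (auto simp: complex_eq_iff)
  next
    case False
    then have pos: "0 < n0 + n3" using le by linarith
    \<comment> \<open>The free phase of the spinor is spent on making \<open>u\<close> positive; the
      off-diagonal entry then determines \<open>v\<close>.\<close>
    define u v where "u = sqrt (n0 + n3)" and "v = Complex (n1 / u) (n2 / u)"
    have u: "0 < u" "u * u = n0 + n3" using pos by (simp_all add: u_def)
    have "n1 / u * (n1 / u) + n2 / u * (n2 / u) = (n1\<^sup>2 + n2\<^sup>2) / (u * u)"
      by (simp add: power2_eq_square add_divide_distrib)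
    also have "\<dots> = n0 - n3" unfolding u(2) m[symmetric] using pos by simp
    finally have "complex_of_real (n0 - n3) = v * cnj v"
      by (simp add: v_def complex_eq_iff)
    moreover have "complex_of_real (n0 + n3) = complex_of_real u * cnj (complex_of_real u)"
      by (simp add: u(2) flip: of_real_mult)
    moreover have "Complex n1 (- n2) = complex_of_real u * cnj v"
      using u by (simp add: v_def complex_eq_iff)
    ultimately show ?thesis using that by blast
  qed
qed

text \<open>For a Lorentz transformation sending the matrix units \<open>E\<^sub>0\<^sub>0\<close> and \<open>E\<^sub>1\<^sub>1\<close> to \<open>a a\<^sup>\<dagger>\<close> and \<open>b b\<^sup>\<dagger>\<close>, the image
  \<open>w\<close> of \<open>E\<^sub>0\<^sub>1\<close> is null and orthogonal to both, hence a multiple of \<open>a b\<^sup>\<dagger>\<close> or of \<open>b a\<^sup>\<dagger>\<close>.\<close>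

lemma polarization_splitting:
  fixes a1 a2 b1 b2 w00 w01 w10 w11 :: complex
  assumes d: "(a1 * b2 - a2 * b1) * (cnj a1 * cnj b2 - cnj a2 * cnj b1) = 1"
    and b: "b2 * cnj b2 * w00 - b2 * cnj b1 * w01 - b1 * cnj b2 * w10 + b1 * cnj b1 * w11 = 0"
    and a: "a2 * cnj a2 * w00 - a2 * cnj a1 * w01 - a1 * cnj a2 * w10 + a1 * cnj a1 * w11 = 0"
    and null: "w00 * w11 = w01 * w10"
    and norm: "w00 * cnj w11 + w11 * cnj w00 - w01 * cnj w01 - w10 * cnj w10 = - 1"
  obtains (direct) w where "w * cnj w = 1" "w00 = w * a1 * cnj b1" "w01 = w * a1 * cnj b2"
      "w10 = w * a2 * cnj b1" "w11 = w * a2 * cnj b2"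
    | (reversed) w where "w * cnj w = 1" "w00 = w * b1 * cnj a1" "w01 = w * b1 * cnj a2"
      "w10 = w * b2 * cnj a1" "w11 = w * b2 * cnj a2"
proof -
  \<comment> \<open>Expansion in the basis a a', b b', a b', b a', where primes stand for the
    conjugates so that all identities are polynomial. The orthogonality hypotheses kill the first
    two coefficients; \<open>w\<close> and \<open>w'\<close> are the other two.\<close>
  have inv: "w00 = w * a1 * b1' + w' * b1 * a1' \<and> w01 = w * a1 * b2' + w' * b1 * a2' \<and>
      w10 = w * a2 * b1' + w' * b2 * a1' \<and> w11 = w * a2 * b2' + w' * b2 * a2' \<and> w * w' = 0"
    if d: "(a1 * b2 - a2 * b1) * (a1' * b2' - a2' * b1') = 1"
      and b: "b2 * b2' * w00 - b2 * b1' * w01 - b1 * b2' * w10 + b1 * b1' * w11 = 0"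
      and a: "a2 * a2' * w00 - a2 * a1' * w01 - a1 * a2' * w10 + a1 * a1' * w11 = 0"
      and w: "w = - b2 * a2' * w00 + b2 * a1' * w01 + b1 * a2' * w10 - b1 * a1' * w11"
      and w': "w' = - a2 * b2' * w00 + a2 * b1' * w01 + a1 * b2' * w10 - a1 * b1' * w11"
    for a1' a2' b1' b2' w w'
  proof -
    have "w00 * ((a1 * b2 - a2 * b1) * (a1' * b2' - a2' * b1')) = w * a1 * b1' + w' * b1 * a1'
        + a1 * a1' * (b2 * b2' * w00 - b2 * b1' * w01 - b1 * b2' * w10 + b1 * b1' * w11)
        + b1 * b1' * (a2 * a2' * w00 - a2 * a1' * w01 - a1 * a2' * w10 + a1 * a1' * w11)"
      unfolding w w' by (simp add: algebra_simps)
    then have 1: "w00 = w * a1 * b1' + w' * b1 * a1'" unfolding a b d by simp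
    have "w01 * ((a1 * b2 - a2 * b1) * (a1' * b2' - a2' * b1')) = w * a1 * b2' + w' * b1 * a2'
        + a1 * a2' * (b2 * b2' * w00 - b2 * b1' * w01 - b1 * b2' * w10 + b1 * b1' * w11)
        + b1 * b2' * (a2 * a2' * w00 - a2 * a1' * w01 - a1 * a2' * w10 + a1 * a1' * w11)"
      unfolding w w' by (simp add: algebra_simps)
    then have 2: "w01 = w * a1 * b2' + w' * b1 * a2'" unfolding a b d by simp
    have "w10 * ((a1 * b2 - a2 * b1) * (a1' * b2' - a2' * b1')) = w * a2 * b1' + w' * b2 * a1'
        + a2 * a1' * (b2 * b2' * w00 - b2 * b1' * w01 - b1 * b2' * w10 + b1 * b1' * w11)
        + b2 * b1' * (a2 * a2' * w00 - a2 * a1' * w01 - a1 * a2' * w10 + a1 * a1' * w11)"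
      unfolding w w' by (simp add: algebra_simps)
    then have 3: "w10 = w * a2 * b1' + w' * b2 * a1'" unfolding a b d by simp
    have "w11 * ((a1 * b2 - a2 * b1) * (a1' * b2' - a2' * b1')) = w * a2 * b2' + w' * b2 * a2'
        + a2 * a2' * (b2 * b2' * w00 - b2 * b1' * w01 - b1 * b2' * w10 + b1 * b1' * w11)
        + b2 * b2' * (a2 * a2' * w00 - a2 * a1' * w01 - a1 * a2' * w10 + a1 * a1' * w11)"
      unfolding w w' by (simp add: algebra_simps)
    then have 4: "w11 = w * a2 * b2' + w' * b2 * a2'" unfolding a b d by simp
    \<comment> \<open>Up to sign this is the determinant of w a b' + w' b a', so nullity makes one
      of the two coefficients vanish.\<close>
    have "(a1 * b2 - a2 * b1) * (a1' * b2' - a2' * b1') * (w * w') = w01 * w10 - w00 * w11"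
      unfolding 1 2 3 4 by (simp add: algebra_simps)
    then have "w * w' = 0" using d null by simp
    with 1 2 3 4 show ?thesis by blast
  qed
  define w w' where "w = - b2 * cnj a2 * w00 + b2 * cnj a1 * w01 + b1 * cnj a2 * w10 - b1 * cnj a1 * w11"
    and "w' = - a2 * cnj b2 * w00 + a2 * cnj b1 * w01 + a1 * cnj b2 * w10 - a1 * cnj b1 * w11"
  note W = inv[OF d b a w_def w'_def]
  show thesis
  proof (cases "w' = 0")
    case True
    have 1: "w00 = w * a1 * cnj b1" "w01 = w * a1 * cnj b2" "w10 = w * a2 * cnj b1" "w11 = w * a2 * cnj b2"
      using W True by simp_all
    have "w00 * cnj w11 + w11 * cnj w00 - w01 * cnj w01 - w10 * cnj w10
      = - (w * cnj w) * ((a1 * b2 - a2 * b1) * (cnj a1 * cnj b2 - cnj a2 * cnj b1))"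
      unfolding 1 by (simp add: algebra_simps)
    then have "w * cnj w = 1" unfolding norm d by simp
    then show thesis using 1 by (rule direct)
  next
    case False
    then have 1: "w00 = w' * b1 * cnj a1" "w01 = w' * b1 * cnj a2" "w10 = w' * b2 * cnj a1" "w11 = w' * b2 * cnj a2"
      using W by simp_all
    have "w00 * cnj w11 + w11 * cnj w00 - w01 * cnj w01 - w10 * cnj w10
      = - (w' * cnj w') * ((a1 * b2 - a2 * b1) * (cnj a1 * cnj b2 - cnj a2 * cnj b1))"
      unfolding 1 by (simp add: algebra_simps)
    then have "w' * cnj w' = 1" unfolding norm d by simp
    then show thesis using 1 by (rule reversed)
  qed
qed

text \<open>The images \<open>A E\<^sub>j\<^sub>k A\<^sup>\<dagger>\<close> of three of the matrix units determine \<open>lorentz_of A\<close>.\<close>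

lemma lorentz_of_tetrad:
  assumes L: "L \<in> carrier_mat 4 4" and d: "cmod (a * d - b * c) = 1"
    and aa: "complex_of_real (L $$ (0,0) + L $$ (0,3) + L $$ (3,0) + L $$ (3,3)) = 2 * (a * cnj a)"
      "complex_of_real (L $$ (0,0) + L $$ (0,3) - L $$ (3,0) - L $$ (3,3)) = 2 * (c * cnj c)"
      "Complex (L $$ (1,0) + L $$ (1,3)) (- (L $$ (2,0) + L $$ (2,3))) = 2 * (a * cnj c)"
    and bb: "complex_of_real (L $$ (0,0) - L $$ (0,3) + L $$ (3,0) - L $$ (3,3)) = 2 * (b * cnj b)"
      "complex_of_real (L $$ (0,0) - L $$ (0,3) - L $$ (3,0) + L $$ (3,3)) = 2 * (d * cnj d)"
      "Complex (L $$ (1,0) - L $$ (1,3)) (- (L $$ (2,0) - L $$ (2,3))) = 2 * (b * cnj d)"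
    and ab: "Complex (L $$ (0,1) + L $$ (3,1)) (L $$ (0,2) + L $$ (3,2)) = 2 * (a * cnj b)"
      "Complex (L $$ (0,1) - L $$ (3,1)) (L $$ (0,2) - L $$ (3,2)) = 2 * (c * cnj d)"
      "Complex (L $$ (1,1) + L $$ (2,2)) (L $$ (1,2) - L $$ (2,1)) = 2 * (a * cnj d)"
      "Complex (L $$ (1,1) - L $$ (2,2)) (L $$ (1,2) + L $$ (2,1)) = 2 * (c * cnj b)"
  shows "corresponds_to (mat_2 a b c d) L"
proof -
  have dA: "Determinant.det (mat_2 a b c d) = a * d - b * c" by (simp add: det_2)
  have cA: "map_mat cnj (mat_2 a b c d) = mat_2 (cnj a) (cnj b) (cnj c) (cnj d)"
    by (rule mat_eqI_2) auto
  define K where "K = T_mat * kron (mat_2 a b c d) (mat_2 (cnj a) (cnj b) (cnj c) (cnj d)) * mat_adjoint T_mat"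
  \<comment> \<open>The hypotheses are linear in the entries of \<open>L\<close>; sums and
    differences of real and imaginary parts isolate each entry.\<close>
  have entries_1:
    "complex_of_real (L $$ (0,0)) = (a * cnj a + b * cnj b + c * cnj c + d * cnj d) / 2"
    "complex_of_real (L $$ (0,3)) = (a * cnj a - b * cnj b + c * cnj c - d * cnj d) / 2"
    "complex_of_real (L $$ (3,0)) = (a * cnj a + b * cnj b - c * cnj c - d * cnj d) / 2"
    "complex_of_real (L $$ (3,3)) = (a * cnj a - b * cnj b - c * cnj c + d * cnj d) / 2"
    by (rule complex_eqI; simp add: algebra_simps;
      (insert aa(1,2)[unfolded complex_eq_iff, simplified, simplified algebra_simps] bb(1,2)[unfolded complex_eq_iff, simplified, simplified algebra_simps], linarith)?)+
  have entries_2: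
    "complex_of_real (L $$ (1,0)) = (a * cnj c + c * cnj a + b * cnj d + d * cnj b) / 2"
    "complex_of_real (L $$ (1,3)) = (a * cnj c + c * cnj a - b * cnj d - d * cnj b) / 2"
    "complex_of_real (L $$ (2,0)) = \<i> * (a * cnj c - c * cnj a + b * cnj d - d * cnj b) / 2"
    "complex_of_real (L $$ (2,3)) = \<i> * (a * cnj c - c * cnj a - b * cnj d + d * cnj b) / 2"
    by (rule complex_eqI; simp add: algebra_simps;
      (insert aa(3)[unfolded complex_eq_iff, simplified, simplified algebra_simps] bb(3)[unfolded complex_eq_iff, simplified, simplified algebra_simps], linarith)?)+
  have entries_3:
    "complex_of_real (L $$ (0,1)) = (a * cnj b + b * cnj a + c * cnj d + d * cnj c) / 2"
    "complex_of_real (L $$ (3,1)) = (a * cnj b + b * cnj a - c * cnj d - d * cnj c) / 2"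
    "complex_of_real (L $$ (0,2)) = \<i> * (b * cnj a - a * cnj b + d * cnj c - c * cnj d) / 2"
    "complex_of_real (L $$ (3,2)) = \<i> * (b * cnj a - a * cnj b - d * cnj c + c * cnj d) / 2"
    by (rule complex_eqI; simp add: algebra_simps;
      (insert ab(1,2)[unfolded complex_eq_iff, simplified, simplified algebra_simps], linarith)?)+
  have entries_4:
    "complex_of_real (L $$ (1,1)) = (a * cnj d + d * cnj a + c * cnj b + b * cnj c) / 2"
    "complex_of_real (L $$ (2,2)) = (a * cnj d + d * cnj a - c * cnj b - b * cnj c) / 2"
    "complex_of_real (L $$ (1,2)) = \<i> * (d * cnj a - a * cnj d + b * cnj c - c * cnj b) / 2"
    "complex_of_real (L $$ (2,1)) = \<i> * (a * cnj d - d * cnj a + b * cnj c - c * cnj b) / 2"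
    by (rule complex_eqI; simp add: algebra_simps;
      (insert ab(3,4)[unfolded complex_eq_iff, simplified, simplified algebra_simps], linarith)?)+
  note entries = entries_1 entries_2 entries_3 entries_4
  have "map_mat complex_of_real L = K"
    by (rule mat_eqI_4)
      (use L in \<open>simp_all add: K_def T_simps kron_index entries[unfolded One_nat_def]\<close>,
       simp_all add: algebra_simps rsqrt2_square)
  moreover have "lorentz_of (mat_2 a b c d) = K"
    unfolding lorentz_of_def cA dA d by (rule eq_matI) (auto simp: K_def)
  ultimately show ?thesis using d by (auto simp: corresponds_to_def dA)
qed

text \<open>The four blocks are multiples of \<open>B\<close> and commute, so the block formula
  gives the determinant of \<open>B * B\<close> scaled by det A.\<close>

lemma det_kron_2:
  fixes A B :: "complex mat"
  assumes A: "A \<in> carrier_mat 2 2" and B: "B \<in> carrier_mat 2 2"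
  shows "Determinant.det (kron A B) = (Determinant.det A)\<^sup>2 * (Determinant.det B)\<^sup>2"
proof -
  let ?b = "\<lambda>i j. A $$ (i, j) \<cdot>\<^sub>m B"
  have b: "?b i j \<in> carrier_mat 2 2" for i j using B by simp
  have m: "?b i j * ?b k l = (A $$ (i, j) * A $$ (k, l)) \<cdot>\<^sub>m (B * B)" for i j k l
    using B by (simp add: mult_smult_assoc_mat[of _ 2 2 _ 2] mult_smult_distrib[of _ 2 2 _ 2]
      smult_smult_mat mult.commute)
  have "kron A B = four_block_mat (?b 0 0) (?b 0 1) (?b 1 0) (?b 1 1)"
  proof (rule eq_matI)
    fix i j assume "i < dim_row (four_block_mat (?b 0 0) (?b 0 1) (?b 1 0) (?b 1 1))"
      "j < dim_col (four_block_mat (?b 0 0) (?b 0 1) (?b 1 0) (?b 1 1))"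
    then have "i < 4" "j < 4" using B by auto
    then show "kron A B $$ (i, j) = four_block_mat (?b 0 0) (?b 0 1) (?b 1 0) (?b 1 1) $$ (i, j)"
      using A B by (auto simp: less_4_iff kron_index)
  qed (use A B in auto)
  also have "Determinant.det \<dots> = Determinant.det (?b 0 0 * ?b 1 1 - ?b 0 1 * ?b 1 0)"
    by (rule det_four_block_mat[of _ 2]) (use b in \<open>auto simp: m mult.commute\<close>)
  also have "?b 0 0 * ?b 1 1 - ?b 0 1 * ?b 1 0 = Determinant.det A \<cdot>\<^sub>m (B * B)"
    unfolding m det_2[OF A] by (rule eq_matI) (use B in \<open>auto simp: left_diff_distrib\<close>)
  also have "Determinant.det \<dots> = (Determinant.det A)\<^sup>2 * (Determinant.det B)\<^sup>2"
    using B by (simp add: det_mult[OF B B] power2_eq_square)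
  finally show ?thesis .
qed

text \<open>The determinant of A tensor cnj A is |det A|^4, which the normalization in dimension 4
  cancels. This rules out reflections in \<open>exists_spinor\<close>.\<close>

lemma det_lorentz_of:
  assumes A: "A \<in> carrier_mat 2 2" and d: "Determinant.det A \<noteq> 0"
  shows "Determinant.det (lorentz_of A) = 1"
proof -
  define n where "n = complex_of_real (cmod (Determinant.det A))"
  have n: "n \<noteq> 0" using d by (simp add: n_def)
  have cA: "map_mat cnj A \<in> carrier_mat 2 2" using A by simp
  have K: "kron A (map_mat cnj A) \<in> carrier_mat 4 4" using A cA by auto
  have Ta: "mat_adjoint T_mat \<in> carrier_mat 4 4" by auto
  have nn: "n\<^sup>2 = Determinant.det A * cnj (Determinant.det A)"
    by (simp add: n_def complex_norm_square del: of_real_power flip: of_real_power)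
  have n4: "n ^ 4 = (n\<^sup>2)\<^sup>2" by (simp flip: power_mult)
  have "Determinant.det (map_mat cnj A) = cnj (Determinant.det A)"
    using A by (simp add: det_2)
  then have "Determinant.det (kron A (map_mat cnj A)) = n ^ 4"
    by (simp add: det_kron_2[OF A cA] n4 nn power_mult_distrib)
  moreover have "Determinant.det T_mat * Determinant.det (mat_adjoint T_mat) = 1"
    using det_mult[OF T_carrier Ta] by (simp add: T_unitary)
  moreover have "Determinant.det (T_mat * kron A (map_mat cnj A) * mat_adjoint T_mat)
     = Determinant.det (kron A (map_mat cnj A)) * (Determinant.det T_mat * Determinant.det (mat_adjoint T_mat))"
    using det_mult[OF mult_carrier_4[OF T_carrier K] Ta] det_mult[OF T_carrier K] by simp
  ultimately show ?thesis
    using n by (simp add: lorentz_of_def n_def[symmetric] power_divide)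
qed

text \<open>The phase \<open>w\<close> is absorbed by the columns u a and cnj u b with u^2 = w: the
  matrices a a^dagger and b b^dagger and the determinant stay the same, while a b^dagger acquires
  the factor \<open>w\<close>.\<close>

lemma spinor_of_frame:
  assumes L: "L \<in> carrier_mat 4 4"
    and aa: "complex_of_real ((L $$ (0,0) + L $$ (0,3)) / 2 + (L $$ (3,0) + L $$ (3,3)) / 2) = a1 * cnj a1"
      "complex_of_real ((L $$ (0,0) + L $$ (0,3)) / 2 - (L $$ (3,0) + L $$ (3,3)) / 2) = a2 * cnj a2"
      "Complex ((L $$ (1,0) + L $$ (1,3)) / 2) (- ((L $$ (2,0) + L $$ (2,3)) / 2)) = a1 * cnj a2"
    and bb: "complex_of_real ((L $$ (0,0) - L $$ (0,3)) / 2 + (L $$ (3,0) - L $$ (3,3)) / 2) = b1 * cnj b1"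
      "complex_of_real ((L $$ (0,0) - L $$ (0,3)) / 2 - (L $$ (3,0) - L $$ (3,3)) / 2) = b2 * cnj b2"
      "Complex ((L $$ (1,0) - L $$ (1,3)) / 2) (- ((L $$ (2,0) - L $$ (2,3)) / 2)) = b1 * cnj b2"
    and d: "(a1 * b2 - a2 * b1) * (cnj a1 * cnj b2 - cnj a2 * cnj b1) = 1"
    and w: "w * cnj w = 1"
    and ab: "Complex ((L $$ (0,1) + L $$ (3,1)) / 2) ((L $$ (0,2) + L $$ (3,2)) / 2) = w * a1 * cnj b1"
      "Complex ((L $$ (1,1) + L $$ (2,2)) / 2) ((L $$ (1,2) - L $$ (2,1)) / 2) = w * a1 * cnj b2"
      "Complex ((L $$ (1,1) - L $$ (2,2)) / 2) ((L $$ (1,2) + L $$ (2,1)) / 2) = w * a2 * cnj b1"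
      "Complex ((L $$ (0,1) - L $$ (3,1)) / 2) ((L $$ (0,2) - L $$ (3,2)) / 2) = w * a2 * cnj b2"
  shows "\<exists>A. corresponds_to A L"
proof -
  have unit: "cmod z = 1" if "z * cnj z = 1" for z
  proof -
    have "complex_of_real ((cmod z)\<^sup>2) = 1" using that by (simp add: complex_norm_square del: of_real_power)
    then have "(cmod z)\<^sup>2 = 1" using of_real_eq_1_iff by blast
    then show ?thesis using power2_eq_1_iff[of "cmod z"] norm_ge_zero[of z] by auto
  qed
  define u where "u = csqrt w"
  have uw: "u * u = w" using power2_csqrt[of w] by (simp add: u_def power2_eq_square)
  have "cmod u * cmod u = 1" using unit[OF w] by (simp flip: norm_mult add: uw)
  then have "cmod u = 1" using norm_ge_zero[of u] by (simp add: square_eq_1_iff)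
  then have uu: "u * cnj u = 1" using complex_norm_square[of u] by simp
  have r1: "u * x * cnj (u * y) = x * cnj y" for x y
  proof -
    have "u * x * cnj (u * y) = (u * cnj u) * (x * cnj y)" by simp
    then show ?thesis unfolding uu by simp
  qed
  have r2: "cnj u * x * cnj (cnj u * y) = x * cnj y" for x y
  proof -
    have "cnj u * x * cnj (cnj u * y) = (u * cnj u) * (x * cnj y)" by simp
    then show ?thesis unfolding uu by simp
  qed
  have r3: "u * x * cnj (cnj u * y) = w * x * cnj y" for x y
    unfolding uw[symmetric] by simp
  have "u * a1 * (cnj u * b2) - cnj u * b1 * (u * a2) = (u * cnj u) * (a1 * b2 - a2 * b1)"
    by (simp add: algebra_simps)
  then have dd: "u * a1 * (cnj u * b2) - cnj u * b1 * (u * a2) = a1 * b2 - a2 * b1"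
    unfolding uu by simp
  have "cmod (a1 * b2 - a2 * b1) = 1" using d by (intro unit) simp
  then have "corresponds_to (mat_2 (u * a1) (cnj u * b1) (u * a2) (cnj u * b2)) L"
    unfolding dd[symmetric]
    by (intro lorentz_of_tetrad[OF L])
      (simp_all only: r1 r2 r3 aa[symmetric] bb[symmetric] ab[symmetric],
       simp_all add: complex_eq_iff add_divide_distrib diff_divide_distrib)
  then show ?thesis by blast
qed

lemma exists_spinor:
  assumes L: "proper_orthochronous L"
  shows "\<exists>A. corresponds_to A L"
proof -
  from L have c: "L \<in> carrier_mat 4 4" and row: "L * minkowski * transpose_mat L = minkowski"
    and det: "Determinant.det L = 1" and pos: "0 < L $$ (0,0)"
    by (auto simp: proper_orthochronous_def)
  have col: "L $$ (0,i) * L $$ (0,j) - L $$ (1,i) * L $$ (1,j) - L $$ (2,i) * L $$ (2,j) - L $$ (3,i) * L $$ (3,j)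
      = (if i = j then if i = 0 then 1 else - 1 else 0)" if "i < 4" "j < 4" for i j
  proof -
    have "(transpose_mat L * minkowski * L) $$ (i, j) = minkowski $$ (i, j)"
      by (simp add: proper_orthochronous_inverse(3)[OF L])
    then show ?thesis using that c
      by (simp add: mult_index_4[of _ 4 _ 4] minkowski_index transpose_index[of _ 4 4])
  qed
  \<comment> \<open>This makes columns 0 plus and minus 3 future directed, as
    \<open>null_vector_spinor\<close> requires.\<close>
  have lt: "\<bar>L $$ (0,3)\<bar> < L $$ (0,0)"
  proof -
    have "(L * minkowski * transpose_mat L) $$ (0, 0) = minkowski $$ (0, 0)" by (simp add: row)
    then have "(L $$ (0,0))\<^sup>2 = 1 + (L $$ (0,1))\<^sup>2 + (L $$ (0,2))\<^sup>2 + (L $$ (0,3))\<^sup>2" using c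
      by (simp add: mult_index_4[of _ 4 _ 4] minkowski_index transpose_index[of _ 4 4] power2_eq_square)
    then have "(L $$ (0,3))\<^sup>2 < (L $$ (0,0))\<^sup>2"
      using zero_le_power2[of "L $$ (0,1)"] zero_le_power2[of "L $$ (0,2)"] by linarith
    then have "\<bar>L $$ (0,3)\<bar> < \<bar>L $$ (0,0)\<bar>" 
      by (intro power2_less_imp_less[of "\<bar>L $$ (0,3)\<bar>"]) simp_all
    then show ?thesis using pos by simp
  qed
  define l00 l01 l02 l03 where "l00 = L $$ (0,0)" and "l01 = L $$ (0,1)" and "l02 = L $$ (0,2)" and "l03 = L $$ (0,3)"
  define l10 l11 l12 l13 where "l10 = L $$ (1,0)" and "l11 = L $$ (1,1)" and "l12 = L $$ (1,2)" and "l13 = L $$ (1,3)"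
  define l20 l21 l22 l23 where "l20 = L $$ (2,0)" and "l21 = L $$ (2,1)" and "l22 = L $$ (2,2)" and "l23 = L $$ (2,3)"
  define l30 l31 l32 l33 where "l30 = L $$ (3,0)" and "l31 = L $$ (3,1)" and "l32 = L $$ (3,2)" and "l33 = L $$ (3,3)"
  note l = l00_def l01_def l02_def l03_def l10_def l11_def l12_def l13_def
    l20_def l21_def l22_def l23_def l30_def l31_def l32_def l33_def
  have col00: "l00 * l00 = 1 + l10 * l10 + l20 * l20 + l30 * l30"
    and col11: "l01 * l01 = l11 * l11 + l21 * l21 + l31 * l31 - 1"
    and col22: "l02 * l02 = l12 * l12 + l22 * l22 + l32 * l32 - 1"
    and col33: "l03 * l03 = l13 * l13 + l23 * l23 + l33 * l33 - 1"
    and col01: "l00 * l01 = l10 * l11 + l20 * l21 + l30 * l31"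
    and col02: "l00 * l02 = l10 * l12 + l20 * l22 + l30 * l32"
    and col03: "l00 * l03 = l10 * l13 + l20 * l23 + l30 * l33"
    and col12: "l01 * l02 = l11 * l12 + l21 * l22 + l31 * l32"
    and col13: "l01 * l03 = l11 * l13 + l21 * l23 + l31 * l33"
    and col23: "l02 * l03 = l12 * l13 + l22 * l23 + l32 * l33"
    using col[of 0 0] col[of 1 1] col[of 2 2] col[of 3 3] col[of 0 1] col[of 0 2] col[of 0 3]
      col[of 1 2] col[of 1 3] col[of 2 3] by (simp_all add: l)
  \<comment> \<open>Half the sum of columns 0 and 3 is the image of |0><0|, half the difference that
    of |1><1|. Both are null because the columns are orthogonal with Minkowski squares 1 and
    -1.\<close>
  have nullp: "((l00 + l03) / 2)\<^sup>2 = ((l10 + l13) / 2)\<^sup>2 + ((l20 + l23) / 2)\<^sup>2 + ((l30 + l33) / 2)\<^sup>2"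
    using col00 col03 col33 by (simp add: power2_eq_square field_simps)
  have nullm: "((l00 - l03) / 2)\<^sup>2 = ((l10 - l13) / 2)\<^sup>2 + ((l20 - l23) / 2)\<^sup>2 + ((l30 - l33) / 2)\<^sup>2"
    using col00 col03 col33 by (simp add: power2_eq_square field_simps)
  obtain a1 a2 where a: "complex_of_real ((l00 + l03) / 2 + (l30 + l33) / 2) = a1 * cnj a1"
      "complex_of_real ((l00 + l03) / 2 - (l30 + l33) / 2) = a2 * cnj a2"
      "Complex ((l10 + l13) / 2) (- ((l20 + l23) / 2)) = a1 * cnj a2"
    using null_vector_spinor[OF nullp] lt by (auto simp: l abs_less_iff)
  obtain b1 b2 where b: "complex_of_real ((l00 - l03) / 2 + (l30 - l33) / 2) = b1 * cnj b1"
      "complex_of_real ((l00 - l03) / 2 - (l30 - l33) / 2) = b2 * cnj b2"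
      "Complex ((l10 - l13) / 2) (- ((l20 - l23) / 2)) = b1 * cnj b2"
    using null_vector_spinor[OF nullm] lt by (auto simp: l abs_less_iff)
  have a4: "Complex ((l10 + l13) / 2) ((l20 + l23) / 2) = a2 * cnj a1"
    using arg_cong[OF a(3), of cnj] by (simp add: complex_eq_iff)
  have b4: "Complex ((l10 - l13) / 2) ((l20 - l23) / 2) = b2 * cnj b1"
    using arg_cong[OF b(3), of cnj] by (simp add: complex_eq_iff)
  \<comment> \<open>The squared modulus of the determinant is twice the Minkowski product of the two
    null vectors, which is (1 + 1) / 2.\<close>
  have "(a1 * b2 - a2 * b1) * (cnj a1 * cnj b2 - cnj a2 * cnj b1)
     = (a1 * cnj a1) * (b2 * cnj b2) + (a2 * cnj a2) * (b1 * cnj b1)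
      - (a1 * cnj a2) * (b2 * cnj b1) - (a2 * cnj a1) * (b1 * cnj b2)"
    by (simp add: algebra_simps)
  also have "\<dots> = 1"
    unfolding a[symmetric] b[symmetric] a4[symmetric] b4[symmetric]
    using col00 col33 by (simp add: complex_eq_iff field_simps)
  finally have d: "(a1 * b2 - a2 * b1) * (cnj a1 * cnj b2 - cnj a2 * cnj b1) = 1" .
  \<comment> \<open>The image of |0><1| = (sigma_1 + i sigma_2) / 2, from columns 1 and 2 of
    \<open>L\<close>.\<close>
  define w00 w01 w10 w11 where "w00 = Complex ((l01 + l31) / 2) ((l02 + l32) / 2)"
    and "w01 = Complex ((l11 + l22) / 2) ((l12 - l21) / 2)"
    and "w10 = Complex ((l11 - l22) / 2) ((l12 + l21) / 2)"
    and "w11 = Complex ((l01 - l31) / 2) ((l02 - l32) / 2)"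
  note w = w00_def w01_def w10_def w11_def
  have 1: "b2 * cnj b2 * w00 - b2 * cnj b1 * w01 - b1 * cnj b2 * w10 + b1 * cnj b1 * w11 = 0"
    unfolding b[symmetric] b4[symmetric] w
    using col01 col02 col13 col23 by (simp add: complex_eq_iff field_simps)
  have 2: "a2 * cnj a2 * w00 - a2 * cnj a1 * w01 - a1 * cnj a2 * w10 + a1 * cnj a1 * w11 = 0"
    unfolding a[symmetric] a4[symmetric] w
    using col01 col02 col13 col23 by (simp add: complex_eq_iff field_simps)
  have 3: "w00 * w11 = w01 * w10"
    unfolding w using col11 col22 col12 by (simp add: complex_eq_iff field_simps)
  have 4: "w00 * cnj w11 + w11 * cnj w00 - w01 * cnj w01 - w10 * cnj w10 = - 1"
    unfolding w using col11 col22 by (simp add: complex_eq_iff field_simps)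
  from d 1 2 3 4 show ?thesis
  proof (cases rule: polarization_splitting)
    case (direct w)
    then show ?thesis
      by (intro spinor_of_frame[where w = w, OF c, folded l, OF a b d]) (simp_all add: w00_def w01_def w10_def w11_def)
  next
    case (reversed w)
    \<comment> \<open>Reflecting the second spatial axis reduces to the first case, but then \<open>det (L * F) = - 1\<close>
      contradicts \<open>det_lorentz_of\<close>.\<close>
    define F where "F = mat_diag 4 (\<lambda>j. if j = 2 then - 1 else 1 :: real)"
    have LF: "(L * F) $$ (i, j) = (if j = 2 then - L $$ (i, j) else L $$ (i, j))" if "i < 4" "j < 4" for i j
      using that c by (simp add: F_def mat_diag_mult_right[OF c])
    have cLF: "L * F \<in> carrier_mat 4 4" using c by (simp add: F_def)
    \<comment> \<open>Negating column 2 exchanges the images of |0><1| and |1><0|, so the matrix of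
      the w's is replaced by its adjoint and w b a^dagger becomes cnj w a b^dagger.\<close>
    have cw: "Complex ((l01 + l31) / 2) ((- l02 - l32) / 2) = cnj w00"
      "Complex ((l11 - l22) / 2) ((- l12 - l21) / 2) = cnj w10"
      "Complex ((l11 + l22) / 2) ((l21 - l12) / 2) = cnj w01"
      "Complex ((l01 - l31) / 2) ((l32 - l02) / 2) = cnj w11"
      by (simp_all add: w00_def w01_def w10_def w11_def complex_eq_iff add_divide_distrib diff_divide_distrib)
    have r: "Complex ((l01 + l31) / 2) ((- l02 - l32) / 2) = cnj w * a1 * cnj b1"
      "Complex ((l11 - l22) / 2) ((- l12 - l21) / 2) = cnj w * a1 * cnj b2"
      "Complex ((l11 + l22) / 2) ((l21 - l12) / 2) = cnj w * a2 * cnj b1"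
      "Complex ((l01 - l31) / 2) ((l32 - l02) / 2) = cnj w * a2 * cnj b2"
      unfolding cw using reversed by simp_all
    have "\<exists>A. corresponds_to A (L * F)"
      by (rule spinor_of_frame[where ?a1.0 = a1 and ?a2.0 = a2 and ?b1.0 = b1 and ?b2.0 = b2 and w = "cnj w"])
        (use a b d reversed(1) r in \<open>simp_all add: cLF LF l[symmetric] l[simplified, symmetric] mult.commute\<close>)
    then obtain A where A: "A \<in> carrier_mat 2 2" "Determinant.det A \<noteq> 0"
        "map_mat complex_of_real (L * F) = lorentz_of A"
      by (auto simp: corresponds_to_def)
    have "Determinant.det F = prod_list (diag_mat F)"
      by (rule det_upper_triangular[of _ 4]) (auto simp: F_def mat_diag_def upper_triangular_def)
    also have "diag_mat F = [1, 1, - 1, 1]"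
      by (simp add: diag_mat_def F_def mat_diag_def numeral_eq_Suc)
    finally have "Determinant.det F = - 1" by simp
    then have "Determinant.det (L * F) = - 1"
      using det_mult[OF c, of F] det by (simp add: F_def)
    then have "Determinant.det (lorentz_of A) = - 1"
      unfolding A(3)[symmetric] by (simp add: of_real_hom.hom_det)
    then show ?thesis using det_lorentz_of[OF A(1,2)] by simp
  qed
qed

section \<open>Filtered states\<close>

lemma mat_trace_smult: "A \<in> carrier_mat n n \<Longrightarrow> mat_trace (c \<cdot>\<^sub>m A) = (c :: complex) * mat_trace A"
  by (simp add: mat_trace_def sum_distrib_left)

lemma filtered_smult:
  assumes A: "A \<in> carrier_mat 2 2" and B: "B \<in> carrier_mat 2 2" and \<rho>: "\<rho> \<in> carrier_mat 4 4"
    and "a \<noteq> 0" "b \<noteq> 0"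
  shows "filtered (a \<cdot>\<^sub>m A) (b \<cdot>\<^sub>m B) \<rho> = filtered A B \<rho>"
proof -
  define M k where "M = kron A B * \<rho> * mat_adjoint (kron A B)" and "k = a * b * cnj (a * b)"
  have K: "kron A B \<in> carrier_mat 4 4" "mat_adjoint (kron A B) \<in> carrier_mat 4 4" using A B by auto
  have M: "M \<in> carrier_mat 4 4" using K \<rho> by (simp add: M_def)
  have k: "k \<noteq> 0" using assms by (simp add: k_def)
  have "kron (a \<cdot>\<^sub>m A) (b \<cdot>\<^sub>m B) * \<rho> * mat_adjoint (kron (a \<cdot>\<^sub>m A) (b \<cdot>\<^sub>m B)) = k \<cdot>\<^sub>m M"
    using K \<rho> by (simp add: kron_smult[OF A B] adjoint_smult smult_mult_4 smult_smult_mat M_def k_def mult_ac)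
  then show ?thesis
    using k by (simp add: filtered_def Let_def M_def[symmetric] mat_trace_smult[OF M] smult_smult_mat)
qed

text \<open>The spin flip identity hands over the inverse: S K^T S / \<delta>, because S squares to
  the identity.\<close>

lemma kron_invertible:
  assumes A: "A \<in> carrier_mat 2 2" "Determinant.det A \<noteq> 0"
    and B: "B \<in> carrier_mat 2 2" "Determinant.det B \<noteq> (0 :: complex)"
  obtains J where "J \<in> carrier_mat 4 4" "J * kron A B = 1\<^sub>m 4" "kron A B * J = 1\<^sub>m 4"
proof
  define S K \<delta> where "S = kron (pauli 2) (pauli 2)" and "K = kron A B"
    and "\<delta> = Determinant.det A * Determinant.det B"
  have [simp]: "S \<in> carrier_mat 4 4" "K \<in> carrier_mat 4 4" using A B by (auto simp: S_def K_def)
  define J where "J = (1 / \<delta>) \<cdot>\<^sub>m (S * transpose_mat K * S)"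
  show J [simp]: "J \<in> carrier_mat 4 4" by (simp add: J_def)
  have "J * K = (1 / \<delta>) \<cdot>\<^sub>m (S * (transpose_mat K * S * K))"
    by (simp add: J_def smult_mult_4 assoc_mult_4)
  also have "transpose_mat K * S * K = \<delta> \<cdot>\<^sub>m S"
    unfolding S_def K_def \<delta>_def by (rule kron_spin_flip[OF A(1) B(1)])
  also have "(1 / \<delta>) \<cdot>\<^sub>m (S * (\<delta> \<cdot>\<^sub>m S)) = 1 \<cdot>\<^sub>m (1\<^sub>m 4)"
    using A B by (simp add: smult_mult_4 smult_smult_mat spin_flip_square[folded S_def] \<delta>_def)
  also have "\<dots> = 1\<^sub>m 4" by (rule eq_matI) auto
  finally show 1: "J * kron A B = 1\<^sub>m 4" by (simp add: K_def)
  show "kron A B * J = 1\<^sub>m 4"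
    by (rule mat_mult_left_right_inverse[OF J _ 1]) (use A B in auto)
qed

lemma concurrence_filtered:
  assumes A: "A \<in> carrier_mat 2 2" and B: "B \<in> carrier_mat 2 2" and X: "X \<in> carrier_mat 4 4"
    and T: "0 < T" "mat_trace (kron A B * (X * mat_adjoint X) * mat_adjoint (kron A B)) = complex_of_real T"
  shows "concurrence (filtered A B (X * mat_adjoint X)) = cmod (Determinant.det A) * cmod (Determinant.det B) / T
    * tau_gap (singular_values (transpose_mat X * kron (pauli 2) (pauli 2) * X))"
proof -
  define S K \<delta> where "S = kron (pauli 2) (pauli 2)" and "K = kron A B"
    and "\<delta> = Determinant.det A * Determinant.det B"
  define z where "z = complex_of_real (1 / sqrt T)"
  have zz: "z * z = 1 / complex_of_real T" "cnj z = z"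
    using T by (simp_all add: z_def flip: of_real_mult)
  have [simp]: "S \<in> carrier_mat 4 4" "K \<in> carrier_mat 4 4" "mat_adjoint K \<in> carrier_mat 4 4"
    "mat_adjoint X \<in> carrier_mat 4 4" using A B X by (auto simp: S_def K_def)
  note [simp] = X
  \<comment> \<open>A factor of the filtered state; 1 / sqrt T on each side accounts for the trace
    normalization.\<close>
  define Y where "Y = z \<cdot>\<^sub>m (K * X)"
  have Y: "Y \<in> carrier_mat 4 4" by (simp add: Y_def)
  have "filtered A B (X * mat_adjoint X) = Y * mat_adjoint Y"
    using T(2) by (simp add: filtered_def K_def[symmetric] Y_def adjoint_smult smult_mult_4 smult_smult_mat
      zz adjoint_mult[of _ 4 4 _ 4] assoc_mult_4)
  moreover have "transpose_mat Y * S * Y = (\<delta> / T) \<cdot>\<^sub>m (transpose_mat X * S * X)"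
  proof -
    have "transpose_mat Y * S * Y = (z * z) \<cdot>\<^sub>m (transpose_mat X * (transpose_mat K * S * K) * X)"
      by (simp add: Y_def transpose_smult_mat smult_mult_4 smult_smult_mat transpose_mult[of _ 4 4 _ 4] assoc_mult_4)
    also have "transpose_mat K * S * K = \<delta> \<cdot>\<^sub>m S"
      unfolding S_def K_def \<delta>_def by (rule kron_spin_flip[OF A B])
    finally show ?thesis by (simp add: smult_mult_4 smult_smult_mat zz)
  qed
  moreover have "cmod (\<delta> / T) = cmod (Determinant.det A) * cmod (Determinant.det B) / T"
    using T by (simp add: \<delta>_def norm_divide norm_mult)
  moreover have "transpose_mat X * S * X \<in> carrier_mat 4 4" by simp
  ultimately show ?thesis
    by (simp only: concurrence_factor[OF Y] S_def[symmetric] tau_gap_smult)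
qed

lemma bell_dim [simp]: "dim_row bell_basis = 4" "dim_col bell_basis = 4"
  by (simp_all add: bell_basis_def mat_of_rows_list_def)

lemma rho_Sigma_bell_diagonal: "diagonal_mat (mat_adjoint bell_basis * rho_Sigma s * bell_basis)"
  unfolding diagonal_mat_def
  by (auto simp: less_4_iff mult_index_4[of _ 4 _ 4] bell_index[simplified] adjoint_index_carrier[of _ 4 4]
    rho_Sigma_eq algebra_simps add_divide_distrib diff_divide_distrib)

lemma psd_diag_entry:
  assumes "psd n D" "i < n"
  shows "D $$ (i, i) = complex_of_real (Re (D $$ (i, i)))" "0 \<le> Re (D $$ (i, i))"
proof -
  have D: "D \<in> carrier_mat n n" and h: "mat_adjoint D = D"
    and p: "\<And>v. v \<in> carrier_vec n \<Longrightarrow> 0 \<le> Re ((D *\<^sub>v v) \<bullet>c v)" using assms by (auto simp: psd_def)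
  have "cnj (D $$ (i, i)) = D $$ (i, i)"
    using adjoint_index_carrier[OF D assms(2,2)] h by simp
  then show "D $$ (i, i) = complex_of_real (Re (D $$ (i, i)))" by (simp add: complex_eq_iff)
  have "conjugate (unit_vec n i :: complex vec) = unit_vec n i"
    by (rule eq_vecI) (auto simp: unit_vec_def conjugate_complex_def)
  then have "(D *\<^sub>v unit_vec n i) \<bullet>c unit_vec n i = D $$ (i, i)"
    using D assms(2) by simp
  then show "0 \<le> Re (D $$ (i, i))" using p[of "unit_vec n i"] by simp
qed

text \<open>The factor is \<open>bell_basis\<close> times the square root of the diagonal form,
  whose entries are nonnegative because congruence preserves positivity.\<close>

lemma rho_Sigma_factor:
  assumes "psd 4 (rho_Sigma s)"
  obtains X where "X \<in> carrier_mat 4 4" "rho_Sigma s = X * mat_adjoint X"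
proof
  define V where "V = bell_basis"
  have [simp]: "V \<in> carrier_mat 4 4" "mat_adjoint V \<in> carrier_mat 4 4" by (auto simp: V_def)
  define D where "D = mat_adjoint V * rho_Sigma s * V"
  have [simp]: "D \<in> carrier_mat 4 4" by (simp add: D_def)
  have "psd 4 D"
    using psd_congruence[OF assms, of "mat_adjoint V" 4] by (simp add: D_def)
  note d = psd_diag_entry[OF this]
  have dg: "diagonal_mat D" unfolding D_def V_def by (rule rho_Sigma_bell_diagonal)
  define Q where "Q = mat_diag 4 (\<lambda>i. complex_of_real (sqrt (Re (D $$ (i, i)))))"
  have [simp]: "Q \<in> carrier_mat 4 4" by (simp add: Q_def)
  have Qa: "mat_adjoint Q = Q"
    by (rule eq_matI) (auto simp: Q_def mat_diag_def adjoint_index)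
  have "Q * Q = D"
    unfolding Q_def mat_diag_diag
  proof (rule eq_matI)
    fix i j assume "i < dim_row D" "j < dim_col D"
    then have ij: "i < 4" "j < 4" using \<open>D \<in> carrier_mat 4 4\<close> by auto
    show "mat_diag 4 (\<lambda>i. complex_of_real (sqrt (Re (D $$ (i, i)))) * complex_of_real (sqrt (Re (D $$ (i, i))))) $$ (i, j)
      = D $$ (i, j)"
    proof (cases "i = j")
      case True
      have "complex_of_real (sqrt (Re (D $$ (j, j)))) * complex_of_real (sqrt (Re (D $$ (j, j)))) = D $$ (j, j)"
        unfolding of_real_mult[symmetric] using d[OF ij(2)] by simp
      with True ij show ?thesis by (simp add: mat_diag_def)
    next
      case False
      with ij dg \<open>D \<in> carrier_mat 4 4\<close> show ?thesis by (auto simp: mat_diag_def diagonal_mat_def)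
    qed
  qed (auto simp: mat_diag_def D_def V_def bell_basis_def mat_of_rows_list_def)
  then have "(V * Q) * mat_adjoint (V * Q) = V * D * mat_adjoint V"
    by (simp add: adjoint_mult[of _ 4 4 _ 4] Qa assoc_mult_4[symmetric]) (simp add: assoc_mult_4)
  also have "\<dots> = (V * mat_adjoint V) * rho_Sigma s * (V * mat_adjoint V)"
    by (simp add: D_def assoc_mult_4)
  also have "\<dots> = rho_Sigma s" by (simp add: V_def bell_unitary one_mult_4)
  finally show "rho_Sigma s = (V * Q) * mat_adjoint (V * Q)" by simp
  show "V * Q \<in> carrier_mat 4 4" by simp
qed

lemma mat_trace_filter:
  assumes A: "A \<in> carrier_mat 2 2" "Determinant.det A \<noteq> 0"
    and B: "B \<in> carrier_mat 2 2" "Determinant.det B \<noteq> 0" and R: "R \<in> carrier_mat 4 4"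
  shows "mat_trace (kron A B * of_pauli_coeffs R * mat_adjoint (kron A B))
    = complex_of_real (cmod (Determinant.det A) * cmod (Determinant.det B))
      * (lorentz_of A * R * transpose_mat (lorentz_of B)) $$ (0, 0)"
  using R by (simp add: of_pauli_coeffs_filter[OF A B R] mat_trace_smult[of _ 4] trace_of_pauli_coeffs)

lemma two_qubit_density_normalized:
  assumes "two_qubit_density \<rho>" and K: "K \<in> carrier_mat 4 4"
    and T: "0 < T" "mat_trace (K * \<rho> * mat_adjoint K) = complex_of_real T"
  shows "two_qubit_density ((1 / mat_trace (K * \<rho> * mat_adjoint K)) \<cdot>\<^sub>m (K * \<rho> * mat_adjoint K))"
proof -
  have p: "psd 4 (K * \<rho> * mat_adjoint K)"
    using assms(1) by (intro psd_congruence[OF _ K]) (simp add: two_qubit_density_def)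
  then have c: "K * \<rho> * mat_adjoint K \<in> carrier_mat 4 4" by (simp add: psd_def)
  have "psd 4 (complex_of_real (1 / T) \<cdot>\<^sub>m (K * \<rho> * mat_adjoint K))"
    using p T by (intro psd_smult) auto
  then show ?thesis
    using T by (simp add: two_qubit_density_def mat_trace_smult[OF c])
qed

theorem mainTheorem5:
  fixes \<rho> :: "complex mat" and R L1 L2 :: "real mat" and s :: "nat \<Rightarrow> real"
  assumes "two_qubit_density \<rho>"
    and "R \<in> carrier_mat 4 4"
    and "\<forall>i<4. \<forall>j<4. complex_of_real (R $$ (i, j)) = mat_trace (\<rho> * kron (pauli i) (pauli j))"
    and "proper_orthochronous L1" and "proper_orthochronous L2"
    and "R = L1 * mat_diag 4 s * transpose_mat L2"
    and "s 0 \<ge> s 1" and "s 1 \<ge> s 2" and "s 2 \<ge> \<bar>s 3\<bar>"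
  defines "K1 \<equiv> minkowski * transpose_mat L1 * minkowski"
    and "K2 \<equiv> minkowski * transpose_mat L2 * minkowski"
  shows "bell_diagonal_state (rho_Sigma s)
    \<and> rho_Sigma s \<in> filtered_states \<rho>
    \<and> (\<forall>\<rho>' \<in> filtered_states \<rho>. concurrence \<rho>' \<le> concurrence (rho_Sigma s))
    \<and> inverts_mat K1 L1 \<and> inverts_mat L1 K1 \<and> inverts_mat K2 L2 \<and> inverts_mat L2 K2
    \<and> (\<exists>A. corresponds_to A K1) \<and> (\<exists>B. corresponds_to B K2)
    \<and> (\<forall>A B. corresponds_to A K1 \<longrightarrow> corresponds_to B K2 \<longrightarrow>
          filter_op (normalize_op A) \<and> filter_op (normalize_op B) \<and>
          filtered (normalize_op A) (normalize_op B) \<rho> = rho_Sigma s)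
    \<and> vec_space.rank 4 (rho_Sigma s) = vec_space.rank 4 \<rho>"
proof -
  note L1 = assms(4) and L2 = assms(5)
  have c: "\<rho> \<in> carrier_mat 4 4" "R \<in> carrier_mat 4 4" "L1 \<in> carrier_mat 4 4" "L2 \<in> carrier_mat 4 4"
    using assms(1,2) L1 L2 by (auto simp: two_qubit_density_def psd_def proper_orthochronous_def)
  note inv1 = proper_orthochronous_inverse[OF L1, folded K1_def]
  note inv2 = proper_orthochronous_inverse[OF L2, folded K2_def]
  have cK: "K1 \<in> carrier_mat 4 4" "K2 \<in> carrier_mat 4 4"
    using inv1(4) inv2(4) by (auto simp: proper_orthochronous_def)
  define Rc where "Rc = map_mat complex_of_real R"
  have Rc: "Rc \<in> carrier_mat 4 4" using c by (simp add: Rc_def)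
  have \<rho>: "\<rho> = of_pauli_coeffs Rc"
    by (rule of_pauli_coeffs_eqI[symmetric]) (use c Rc assms(3) in \<open>auto simp: Rc_def\<close>)
  have s: "\<bar>s 1\<bar> \<le> s 0" "\<bar>s 2\<bar> \<le> s 0" "\<bar>s 3\<bar> \<le> s 0" using assms(7-9) by auto
  \<comment> \<open>Otherwise |s_i| \<le> s_0 forces every s_i to vanish, hence
    \<open>R = 0\<close>, although R_00 is the trace of \<open>\<rho>\<close>.\<close>
  have s0: "0 < s 0"
  proof (rule ccontr)
    assume "\<not> 0 < s 0"
    then have z: "s i = 0" if "i < 4" for i using s that by (auto simp: less_4_iff)
    have "mat_diag 4 s = 0\<^sub>m 4 4" by (rule eq_matI) (auto simp: mat_diag_def z)
    then have "R = 0\<^sub>m 4 4" using assms(6) c by simp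
    then have "Rc $$ (0, 0) = 0" by (simp add: Rc_def)
    then show False
      using assms(1) trace_of_pauli_coeffs[OF Rc] by (simp add: two_qubit_density_def \<rho>)
  qed
  have trace_bound: "\<exists>t\<ge>s 0. mat_trace (kron A B * \<rho> * mat_adjoint (kron A B))
      = complex_of_real (cmod (Determinant.det A) * cmod (Determinant.det B) * t)"
    if A: "A \<in> carrier_mat 2 2" "Determinant.det A \<noteq> 0"
      and B: "B \<in> carrier_mat 2 2" "Determinant.det B \<noteq> 0" for A B
  proof -
    obtain t where "s 0 \<le> t"
      "(lorentz_of A * Rc * transpose_mat (lorentz_of B)) $$ (0, 0) = complex_of_real t"
      using lorentz_corner_bound[OF A B L1 L2 s] unfolding Rc_def assms(6) by blast
    then show ?thesis
      by (intro exI[of _ t]) (simp add: \<rho> mat_trace_filter[OF A B Rc])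
  qed
  \<comment> \<open>Here \<open>K1 * R * transpose_mat K2\<close> collapses to the diagonal matrix,
    because \<open>K1\<close> and \<open>K2\<close> invert \<open>L1\<close> and
    \<open>L2\<close>.\<close>
  have filter: "kron A B * \<rho> * mat_adjoint (kron A B)
      = complex_of_real (cmod (Determinant.det A) * cmod (Determinant.det B) * s 0) \<cdot>\<^sub>m rho_Sigma s"
    if A: "corresponds_to A K1" and B: "corresponds_to B K2" for A B
  proof -
    have A': "A \<in> carrier_mat 2 2" "Determinant.det A \<noteq> 0" "lorentz_of A = map_mat complex_of_real K1"
      and B': "B \<in> carrier_mat 2 2" "Determinant.det B \<noteq> 0" "lorentz_of B = map_mat complex_of_real K2"
      using A B by (auto simp: corresponds_to_def)
    have "transpose_mat L2 * transpose_mat K2 = 1\<^sub>m 4"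
      using transpose_mult[OF cK(2) c(4)] inv2(2) by simp
    moreover have "K1 * R * transpose_mat K2 = (K1 * L1) * mat_diag 4 s * (transpose_mat L2 * transpose_mat K2)"
      using c cK by (simp add: assms(6) assoc_mult_4)
    ultimately have "K1 * R * transpose_mat K2 = mat_diag 4 s"
      by (simp add: inv1(2) one_mult_4)
    moreover have "lorentz_of A * Rc * transpose_mat (lorentz_of B) = map_mat complex_of_real (K1 * R * transpose_mat K2)"
      using c cK by (simp add: A'(3) B'(3) Rc_def of_real_hom.mat_hom_mult[of _ 4 4 _ 4] map_mat_transpose)
    moreover have "map_mat complex_of_real (mat_diag 4 s) = mat_diag 4 (\<lambda>i. complex_of_real (s i))"
      by (rule eq_matI) (auto simp: mat_diag_def)
    ultimately have "of_pauli_coeffs (lorentz_of A * Rc * transpose_mat (lorentz_of B))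
        = complex_of_real (s 0) \<cdot>\<^sub>m rho_Sigma s"
      using of_pauli_coeffs_diag[of s] s0 by simp
    then show ?thesis
      using of_pauli_coeffs_filter[OF A'(1,2) B'(1,2) Rc] by (simp add: \<rho> smult_smult_mat)
  qed
  obtain A0 where A0: "corresponds_to A0 K1" using exists_spinor[OF inv1(4)] by blast
  obtain B0 where B0: "corresponds_to B0 K2" using exists_spinor[OF inv2(4)] by blast
  have a0: "A0 \<in> carrier_mat 2 2" "Determinant.det A0 \<noteq> 0" and b0: "B0 \<in> carrier_mat 2 2" "Determinant.det B0 \<noteq> 0"
    using A0 B0 by (auto simp: corresponds_to_def)
  define K where "K = kron A0 B0"
  have K: "K \<in> carrier_mat 4 4" using a0 b0 by (auto simp: K_def)
  define T where "T = cmod (Determinant.det A0) * cmod (Determinant.det B0) * s 0"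
  have T: "0 < T" using a0 b0 s0 by (simp add: T_def)
  have KT: "K * \<rho> * mat_adjoint K = complex_of_real T \<cdot>\<^sub>m rho_Sigma s"
    unfolding K_def T_def by (rule filter[OF A0 B0])
  have trS: "mat_trace (rho_Sigma s) = 1"
  proof -
    have "complex_of_real (s 0) * mat_trace (rho_Sigma s) = complex_of_real (s 0)"
      using s0 trace_of_pauli_coeffs[of "mat_diag 4 (\<lambda>i. complex_of_real (s i))"]
      by (simp add: of_pauli_coeffs_diag mat_trace_smult[of _ 4]) (simp add: mat_diag_def)
    then show ?thesis using s0 by simp
  qed
  have trT: "mat_trace (K * \<rho> * mat_adjoint K) = complex_of_real T"
    unfolding KT by (simp add: mat_trace_smult[of _ 4] trS)
  have unscale: "(1 / complex_of_real t) \<cdot>\<^sub>m (complex_of_real t \<cdot>\<^sub>m M) = M" if "t \<noteq> 0" for t and M :: "complex mat"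
    using that by (intro eq_matI) auto
  have filtered_eq: "filtered A B \<rho> = rho_Sigma s" if A: "corresponds_to A K1" and B: "corresponds_to B K2" for A B
  proof -
    have "Determinant.det A \<noteq> 0" "Determinant.det B \<noteq> 0" using A B by (auto simp: corresponds_to_def)
    then show ?thesis
      using s0 by (simp only: filtered_def Let_def filter[OF A B] mat_trace_smult[OF rho_Sigma_carrier] trS mult_1_right)
        (rule unscale, simp)
  qed
  \<comment> \<open>Positivity of \<open>rho_Sigma s\<close> comes from \<open>\<rho>\<close>, of
    which it is a normalized congruence transform.\<close>
  have density: "two_qubit_density (rho_Sigma s)"
    using two_qubit_density_normalized[OF assms(1) K T trT] T unfolding trT by (simp add: KT unscale)
  then have bell: "bell_diagonal_state (rho_Sigma s)"
    using rho_Sigma_bell_diagonal by (simp add: bell_diagonal_state_def)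
  have normalized: "filter_op (normalize_op A) \<and> filter_op (normalize_op B) \<and>
      filtered (normalize_op A) (normalize_op B) \<rho> = rho_Sigma s"
    if A: "corresponds_to A K1" and B: "corresponds_to B K2" for A B
  proof -
    have A': "A \<in> carrier_mat 2 2" "Determinant.det A \<noteq> 0" and B': "B \<in> carrier_mat 2 2" "Determinant.det B \<noteq> 0"
      using A B by (auto simp: corresponds_to_def)
    have "filtered (normalize_op A) (normalize_op B) \<rho> = filtered A B \<rho>"
      unfolding normalize_op_def
      using largest_singular_value_2(1)[OF A'] largest_singular_value_2(1)[OF B']
      by (intro filtered_smult A'(1) B'(1) c(1)) auto
    then show ?thesis using filter_op_normalize[OF A'] filter_op_normalize[OF B'] filtered_eq[OF A B] by simp
  qed
  have attained: "rho_Sigma s \<in> filtered_states \<rho>"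
    using normalized[OF A0 B0] unfolding filtered_states_def by (metis (mono_tags, lifting) mem_Collect_eq)
  obtain J where J: "J \<in> carrier_mat 4 4" "J * K = 1\<^sub>m 4" "K * J = 1\<^sub>m 4"
    using kron_invertible[OF a0 b0] unfolding K_def by blast
  have Ja: "mat_adjoint J \<in> carrier_mat 4 4" "mat_adjoint K \<in> carrier_mat 4 4" using J K by auto
  have one: "mat_adjoint (1\<^sub>m 4 :: complex mat) = 1\<^sub>m 4"
    by (rule eq_matI) (auto simp: adjoint_index)
  have KJ: "mat_adjoint K * mat_adjoint J = 1\<^sub>m 4"
    using adjoint_mult[OF J(1) K] J one by simp
  obtain X0 where X0: "X0 \<in> carrier_mat 4 4" "rho_Sigma s = X0 * mat_adjoint X0"
    using rho_Sigma_factor density by (auto simp: two_qubit_density_def)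
  obtain X where X: "X \<in> carrier_mat 4 4" "\<rho> = X * mat_adjoint X"
  proof
    \<comment> \<open>Undoing the filter by \<open>J\<close> leaves the factor \<open>T\<close>,
      which \<open>z\<close> distributes over both sides.\<close>
    define z where "z = complex_of_real (sqrt T)"
    have zz: "z * cnj z = complex_of_real T" using T by (simp add: z_def flip: of_real_mult)
    show "z \<cdot>\<^sub>m (J * X0) \<in> carrier_mat 4 4" using J X0 by simp
    have X0a: "mat_adjoint X0 \<in> carrier_mat 4 4" using X0 by auto
    have "\<rho> = (J * K) * \<rho> * (mat_adjoint K * mat_adjoint J)"
      using c by (simp add: J KJ one_mult_4)
    also have "\<dots> = J * (K * \<rho> * mat_adjoint K) * mat_adjoint J"
      using J(1) K c(1) Ja by (simp add: assoc_mult_4)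
    also have "\<dots> = complex_of_real T \<cdot>\<^sub>m (J * X0 * (mat_adjoint X0 * mat_adjoint J))"
      unfolding KT X0(2) using J(1) X0(1) X0a Ja by (simp add: smult_mult_4 assoc_mult_4)
    also have "\<dots> = (z \<cdot>\<^sub>m (J * X0)) * mat_adjoint (z \<cdot>\<^sub>m (J * X0))"
      using J(1) X0(1) X0a Ja
      by (simp add: adjoint_smult adjoint_mult[of _ 4 4 _ 4] smult_mult_4 smult_smult_mat zz mult.commute)
    finally show "\<rho> = (z \<cdot>\<^sub>m (J * X0)) * mat_adjoint (z \<cdot>\<^sub>m (J * X0))" .
  qed
  define g where "g = tau_gap (singular_values (transpose_mat X * kron (pauli 2) (pauli 2) * X))"
  have g: "0 \<le> g" by (simp add: g_def tau_gap_def)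
  \<comment> \<open>The determinants cancel: \<open>g\<close> depends on the factor of
    \<open>\<rho>\<close> only and the filter enters through \<open>t\<close> alone, so the smallest
    admissible value t = s_0 is optimal.\<close>
  have conc: "concurrence (filtered A B \<rho>) = g / t"
    if A: "A \<in> carrier_mat 2 2" "Determinant.det A \<noteq> 0"
      and B: "B \<in> carrier_mat 2 2" "Determinant.det B \<noteq> 0" and t: "s 0 \<le> t"
      "mat_trace (kron A B * \<rho> * mat_adjoint (kron A B))
        = complex_of_real (cmod (Determinant.det A) * cmod (Determinant.det B) * t)" for A B t
  proof -
    have "0 < cmod (Determinant.det A) * cmod (Determinant.det B) * t" using A B t s0 by simp
    from concurrence_filtered[OF A(1) B(1) X(1) this] t(2) show ?thesis
      using A B by (simp add: X(2) g_def)
  qed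
  have concS: "concurrence (rho_Sigma s) = g / s 0"
    using conc[OF a0 b0 order_refl trT[unfolded K_def T_def]] filtered_eq[OF A0 B0] by simp
  have maximal: "concurrence \<rho>' \<le> concurrence (rho_Sigma s)" if "\<rho>' \<in> filtered_states \<rho>" for \<rho>'
  proof -
    from that obtain A B where \<rho>': "\<rho>' = filtered A B \<rho>" "filter_op A" "filter_op B"
      by (auto simp: filtered_states_def)
    then have A: "A \<in> carrier_mat 2 2" "Determinant.det A \<noteq> 0" and B: "B \<in> carrier_mat 2 2" "Determinant.det B \<noteq> 0"
      by (auto simp: filter_op_def)
    obtain t where t: "s 0 \<le> t" "mat_trace (kron A B * \<rho> * mat_adjoint (kron A B))
        = complex_of_real (cmod (Determinant.det A) * cmod (Determinant.det B) * t)"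
      using trace_bound[OF A B] by blast
    have "g / t \<le> g / s 0" using g t(1) s0 by (intro divide_left_mono) auto
    then show ?thesis using conc[OF A B t] \<rho>'(1) concS by simp
  qed
  have rank: "vec_space.rank 4 (rho_Sigma s) = vec_space.rank 4 \<rho>"
  proof -
    \<comment> \<open>The scalar is moved into the left factor, so that the rank lemma applies to a
      product of three matrices.\<close>
    have "rho_Sigma s = complex_of_real (1 / T) \<cdot>\<^sub>m (K * \<rho> * mat_adjoint K)"
      using T by (simp add: KT unscale)
    also have "\<dots> = (complex_of_real (1 / T) \<cdot>\<^sub>m K) * \<rho> * mat_adjoint K"
      using K c Ja by (simp add: smult_mult_4)
    finally have S: "rho_Sigma s = (complex_of_real (1 / T) \<cdot>\<^sub>m K) * \<rho> * mat_adjoint K" .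
    have "(complex_of_real T \<cdot>\<^sub>m J) * (complex_of_real (1 / T) \<cdot>\<^sub>m K) = 1\<^sub>m 4"
      using J K T by (simp add: smult_mult_4 smult_smult_mat) (rule eq_matI, auto)
    then show ?thesis
      unfolding S using K J Ja KJ c
      by (intro vec_space.rank_congruence_invertible[where J = "complex_of_real T \<cdot>\<^sub>m J" and Q = "mat_adjoint J"]) auto
  qed
  have "inverts_mat K1 L1" "inverts_mat L1 K1" "inverts_mat K2 L2" "inverts_mat L2 K2"
    using inv1 inv2 c cK by (auto simp: inverts_mat_def)
  then show ?thesis
    using bell attained maximal A0 B0 normalized rank by blast
qed

end
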